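(* Let $s_0=\sigma+i\rho$ with $0<\sigma\le 1/2$ and $\rho\ge 0$, suppose $\zeta'(s_0)\neq 0$, and suppose $s_0\neq 1/2+i\rho_s$. Then $\zeta(s_0)=0$ if and only if $\mathfrak{L}(s_0)=0$, i.e. if and only if $$\frac{\zeta'(1-s_0)}{\zeta'(s_0)} = -2\cos(\pi s_0/2)\,\Gamma(s_0)\,(2\pi)^{-s_0}.$$
   Context: $\zeta$ is the Riemann zeta function and $\zeta'$ its complex derivative; thus $\zeta'(1-s)$ means $\zeta'$ evaluated at $1-s$. Define $$\mathfrak{L}(s)=\frac{\zeta'(1-s)}{\zeta'(s)}+2\cos(\pi s/2)\,\Gamma(s)\,(2\pi)^{-s}.$$ With $\psi=\Gamma'/\Gamma$ the digamma function, $\rho_s=6.2898\ldots$ is the unique $\rho>0$ satisfying $$\mathrm{Re}\,\psi(1/2+i\rho)=\frac{\ln(2\pi)\cosh(\pi\rho)+\pi/2}{\cosh(\pi\rho)}.$$ *)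

theory Defs
  imports "HOL-Complex_Analysis.Complex_Analysis"
begin

text \<open>
  The Riemann zeta function: the analytic continuation to the complex plane without \<open>1\<close> of the
  Dirichlet series. The clause \<open>f 1 = 0\<close> only fixes a value at the pole, so that the total
  function is unique.
\<close>

definition zeta :: "complex \<Rightarrow> complex" where
  "zeta = (THE f. f holomorphic_on (- {1}) \<and>
                  (\<forall>s. Re s > 1 \<longrightarrow> f s = (\<Sum>n. 1 / of_nat (Suc n) powr s)) \<and>
                  f 1 = 0)"

definition frakL :: "complex \<Rightarrow> complex" where
  "frakL s = deriv zeta (1 - s) / deriv zeta s
             + 2 * cos (of_real pi * s / 2) * Gamma s * of_real (2 * pi) powr (- s)"

definition rho_s :: real where
  "rho_s = (THE \<rho>. \<rho> > 0 \<and>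
      Re (Digamma (1 / 2 + \<i> * of_real \<rho>))
        = (ln (2 * pi) * cosh (pi * \<rho>) + pi / 2) / cosh (pi * \<rho>))"

end

(*
Let A(s) = 2 cos(pi s/2) Gamma(s) (2 pi)^(-s) (zeta_factor below), so that the functional equation
reads zeta(1 - s) = A(s) zeta(s). Differentiating it gives frakL(s) = - A'(s) zeta(s) / zeta'(s), and
A has no zeros in the strip, so everything reduces to the zeros of
A'/A = psi(s) - ln(2 pi) - (pi/2) tan(pi s/2).
For t > 0 the imaginary part of A'/A at sigma + i t vanishes on the critical line (reflection formula
for psi) and is positive to the left of it, because both of its terms decrease in sigma. On the
critical line the real part of A'/A is strictly increasing in t > 0, so that it vanishes at most at
rho_s. On the real segment A'/A is negative since psi(1/2) < 0.

The functional equation is obtained from Mellin transforms (Titchmarsh, section 2.7): for Re s > 1,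
Gamma(s) zeta(s) is the Mellin transform of 1/(e^x - 1). Subtracting e^(-x) (1/x + 1/2) cancels the
singular part at 0 and continues zeta to Re s > -1. For -1 < s < 0 the same transform can be evaluated
termwise through 1/(e^x - 1) - 1/x + 1/2 = sum 2x/(x^2 + 4 pi^2 n^2), which produces zeta(1 - s).
*)

theory Submission
  imports Defs "HOL-Real_Asymp.Real_Asymp"
begin

section \<open>Improper integrals\<close>

text \<open>Dominated convergence with majorant |f|: each x > 0 lies in the n-th interval as soon as
  n is at least max(x, 1/x), so the truncated functions are eventually equal to f at every
  point.\<close>

lemma tendsto_integral_exhaustion:
  fixes f :: "real \<Rightarrow> real"
  assumes "f absolutely_integrable_on {0<..}"
  shows "(\<lambda>n. integral {1 / Suc n .. real (Suc n)} f) \<longlonglongrightarrow> integral {0<..} f"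
proof -
  let ?K = "\<lambda>n. {1 / Suc n .. real (Suc n)}"
  have K: "?K n \<subseteq> {0<..}" for n
    by (auto intro: less_le_trans[of 0 "1 / (1 + real n)"])
  have "(\<lambda>n. integral {0<..} (\<lambda>x. if x \<in> ?K n then f x else 0)) \<longlonglongrightarrow> integral {0<..} f"
  proof (rule dominated_convergence(2))
    show "(\<lambda>x. \<bar>f x\<bar>) integrable_on {0<..}"
      using assms by (simp add: absolutely_integrable_on_def)
    show "(\<lambda>x. if x \<in> ?K n then f x else 0) integrable_on {0<..}" for n
    proof -
      have "f integrable_on ?K n"
        by (rule set_lebesgue_integral_eq_integral(1), rule set_integrable_subset[OF assms _ K]) auto
      then show ?thesis
        using integrable_restrict_Int[of "?K n" f "{0<..}"] K[of n] by (simp add: Int_absorb2)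
    qed
    show "norm (if x \<in> ?K n then f x else 0) \<le> \<bar>f x\<bar>" for n x
      by auto
    show "(\<lambda>n. if x \<in> ?K n then f x else 0) \<longlonglongrightarrow> f x" if "x \<in> {0<..}" for x
    proof (rule tendsto_eventually)
      have "eventually (\<lambda>n. real n \<ge> max x (1/x)) sequentially"
        by real_asymp
      then show "eventually (\<lambda>n. (if x \<in> ?K n then f x else 0) = f x) sequentially"
        by eventually_elim (use that in \<open>auto simp: field_simps\<close>)
    qed
  qed
  moreover have "integral {0<..} (\<lambda>x. if x \<in> ?K n then f x else 0) = integral (?K n) f" for n
    using integral_restrict_Int[of "{0<..}" "?K n" f] Int_absorb2[OF K] by simp
  ultimately show ?thesis by simp
qed

text \<open>Integration by parts on the half line: \<open>P\<close> is the boundary term, vanishing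
  at both ends, and \<open>q\<close> is the integrand of known integrability. Integrability of f is
  part of the conclusion. The fundamental theorem gives the truncated integrals of f, and since f is
  nonnegative and they converge, monotone convergence applies.\<close>

lemma has_integral_FTC_exhaustion:
  fixes f q P :: "real \<Rightarrow> real"
  assumes f: "\<And>x. x > 0 \<Longrightarrow> f x \<ge> 0"
    and q: "q absolutely_integrable_on {0<..}"
    and P: "\<And>x. x > 0 \<Longrightarrow> (P has_real_derivative f x + q x) (at x)"
    and "(P \<longlongrightarrow> 0) (at_right 0)" "(P \<longlongrightarrow> 0) at_top"
  shows "(f has_integral - integral {0<..} q) {0<..}"
proof -
  let ?K = "\<lambda>n. {1 / Suc n .. real (Suc n)}"
  have K: "?K n \<subseteq> {0<..}" for n
    by (auto intro: less_le_trans[of 0 "1 / (1 + real n)"])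
  have qK: "q integrable_on ?K n" for n
    by (rule set_lebesgue_integral_eq_integral(1), rule set_integrable_subset[OF q _ K]) auto
  have int: "(f has_integral (P (Suc n) - P (1 / Suc n)) - integral (?K n) q) (?K n)" for n
  proof -
    have "((\<lambda>x. f x + q x) has_integral P (Suc n) - P (1 / Suc n)) (?K n)"
    proof (rule fundamental_theorem_of_calculus)
      show "1 / real (Suc n) \<le> real (Suc n)" by (simp add: field_simps)
      show "(P has_vector_derivative f x + q x) (at x within ?K n)" if "x \<in> ?K n" for x
      proof -
        have "x > 0" using K[of n] that by blast
        from has_field_derivative_at_within[OF P[OF this]] show ?thesis
          by (simp add: has_real_derivative_iff_has_vector_derivative)
      qed
    qed
    from has_integral_diff[OF this integrable_integral[OF qK]] show ?thesis by simp
  qed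
  have "(\<lambda>n. P (Suc n) - P (1 / Suc n) - integral (?K n) q) \<longlonglongrightarrow> 0 - 0 - integral {0<..} q"
  proof (intro tendsto_diff tendsto_integral_exhaustion[OF q])
    show "(\<lambda>n. P (Suc n)) \<longlonglongrightarrow> 0"
      by (rule filterlim_compose[OF assms(5)]) real_asymp
    show "(\<lambda>n. P (1 / Suc n)) \<longlonglongrightarrow> 0"
      by (rule filterlim_compose[OF assms(4)]) real_asymp
  qed
  then have lim: "(\<lambda>n. integral (?K n) f) \<longlonglongrightarrow> - integral {0<..} q"
    unfolding integral_unique[OF int] by simp
  have res: "(\<lambda>x. if x \<in> ?K n then f x else 0) integrable_on {0<..}"
    "integral {0<..} (\<lambda>x. if x \<in> ?K n then f x else 0) = integral (?K n) f" for n
  proof -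
    show "(\<lambda>x. if x \<in> ?K n then f x else 0) integrable_on {0<..}"
      using int[of n] integrable_restrict_Int[of "?K n" f "{0<..}"] Int_absorb2[OF K]
      by auto
    show "integral {0<..} (\<lambda>x. if x \<in> ?K n then f x else 0) = integral (?K n) f"
      using integral_restrict_Int[of "{0<..}" "?K n" f] Int_absorb2[OF K] by simp
  qed
  have "f integrable_on {0<..} \<and>
      (\<lambda>n. integral {0<..} (\<lambda>x. if x \<in> ?K n then f x else 0)) \<longlonglongrightarrow> integral {0<..} f"
  proof (rule monotone_convergence_increasing[OF res(1)])
    show "(if x \<in> ?K n then f x else 0) \<le> (if x \<in> ?K (Suc n) then f x else 0)" if "x \<in> {0<..}" for n x
    proof -
      have "1 / real (Suc (Suc n)) \<le> 1 / real (Suc n)" by (simp add: field_simps)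
      then have "x \<in> ?K n \<Longrightarrow> x \<in> ?K (Suc n)" by auto
      then show ?thesis using f[of x] that by (auto simp del: atLeastAtMost_iff)
    qed
    show "(\<lambda>n. if x \<in> ?K n then f x else 0) \<longlonglongrightarrow> f x" if "x \<in> {0<..}" for x
    proof (rule tendsto_eventually)
      have "eventually (\<lambda>n. real n \<ge> max x (1/x)) sequentially"
        by real_asymp
      then show "eventually (\<lambda>n. (if x \<in> ?K n then f x else 0) = f x) sequentially"
        by eventually_elim (use that in \<open>auto simp: field_simps\<close>)
    qed
    show "bounded (range (\<lambda>n. integral {0<..} (\<lambda>x. if x \<in> ?K n then f x else 0)))"
      unfolding res(2) using lim by (intro convergent_imp_bounded)
  qed
  then show ?thesis
    unfolding res(2) using LIMSEQ_unique[OF lim, of "integral {0<..} f"] unfolding has_integral_iff by simp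
qed

text \<open>Subtracting Taylor polynomials of e^(-x) at 0 continues Euler's integral to the left of
  Re s = 0. Integration by parts, once for the first formula and twice for the second, reduces both
  to the convergent integral for Gamma(s + 1), whose integrand is \<open>q\<close>.\<close>

lemma has_integral_Gamma_regularized:
  assumes "-1 < s" "s < (0::real)"
  shows "((\<lambda>x. x powr (s - 1) * (1 - exp (- x))) has_integral - Gamma s) {0<..}"
    and "((\<lambda>x. x powr (s - 2) * (exp (- x) - 1 + x)) has_integral Gamma (s - 1)) {0<..}"
proof -
  define q where "q = (\<lambda>x. x powr s / exp x)"
  have qi: "(q has_integral Gamma (s + 1)) {0<..}"
  proof (subst has_integral_spike_set_eq)
    show "(q has_integral Gamma (s + 1)) {0..}"
      using Gamma_integral_real[of "s + 1"] assms by (simp add: q_def)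
  qed (rule negligible_subset[of "{0}"]; auto)+
  then have q: "q absolutely_integrable_on {0<..}"
    by (intro nonnegative_absolutely_integrable_1) (auto simp: q_def)
  have "s \<notin> \<int>"
  proof
    assume "s \<in> \<int>"
    then obtain n where "s = of_int n" by (auto elim: Ints_cases)
    then show False using assms by simp
  qed
  then have "s \<notin> \<int>\<^sub>\<le>\<^sub>0" "s - 1 \<notin> \<int>\<^sub>\<le>\<^sub>0"
    using Ints_add[OF _ Ints_1, of "s - 1"] by (auto dest: nonpos_Ints_Int)
  then have G: "Gamma (s + 1) = s * Gamma s" "Gamma s = (s - 1) * Gamma (s - 1)"
    using Gamma_plus1[of s] Gamma_plus1[of "s - 1"] by auto
  have exp1: "exp (-x) \<ge> 1 - x" for x :: real using exp_ge_add_one_self[of "-x"] by simp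
  have "((\<lambda>x. x powr (s - 1) * (1 - exp (- x))) has_integral - integral {0<..} (\<lambda>x. q x / s)) {0<..}"
  \<comment> \<open>The boundary term is of order x^(s+1) at 0 and x^s at infinity, so -1 < s < 0 is
    exactly what makes it vanish at both ends.\<close>
  proof (rule has_integral_FTC_exhaustion[where P = "\<lambda>x. x powr s / s * (1 - exp (-x))"])
    show "(\<lambda>x. q x / s) absolutely_integrable_on {0<..}" using q by (rule set_integrable_divide)
    show "((\<lambda>x. x powr s / s * (1 - exp (-x))) has_real_derivative
        x powr (s - 1) * (1 - exp (- x)) + q x / s) (at x)" if "x > 0" for x
      using that assms by (auto intro!: derivative_eq_intros simp: q_def exp_minus field_simps powr_diff)
    show "((\<lambda>x. x powr s / s * (1 - exp (-x))) \<longlongrightarrow> 0) (at_right 0)"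
      "((\<lambda>x. x powr s / s * (1 - exp (-x))) \<longlongrightarrow> 0) at_top"
      using assms by real_asymp+
  qed auto
  then show "((\<lambda>x. x powr (s - 1) * (1 - exp (- x))) has_integral - Gamma s) {0<..}"
    using qi assms by (simp add: integral_unique G(1))
  have "((\<lambda>x. x powr (s - 2) * (exp (- x) - 1 + x)) has_integral
      - integral {0<..} (\<lambda>x. - (q x / (s * (s - 1))))) {0<..}"
  \<comment> \<open>Two integrations by parts at once: differentiating the first summand leaves
    x^(s-1) (1 - e^(-x)) / (s - 1), which the second summand cancels at the cost of - q / (s (s -
    1)).\<close>
  proof (rule has_integral_FTC_exhaustion[where
        P = "\<lambda>x. x powr (s - 1) / (s - 1) * (exp (-x) - 1 + x) - x powr s / (s * (s - 1)) * (1 - exp (-x))"])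
    show "(\<lambda>x. - (q x / (s * (s - 1)))) absolutely_integrable_on {0<..}"
      using set_integrable_divide[OF q, of "- (s * (s - 1))"] by simp
    show "((\<lambda>x. x powr (s - 1) / (s - 1) * (exp (-x) - 1 + x) - x powr s / (s * (s - 1)) * (1 - exp (-x)))
        has_real_derivative x powr (s - 2) * (exp (- x) - 1 + x) + - (q x / (s * (s - 1)))) (at x)"
      if "x > 0" for x
    proof -
      have p: "x powr (s - 1) = x powr s / x" "x powr (s - 2) = x powr s / x / x"
        "x powr (s - 1 - 1) = x powr s / x / x"
        using that by (simp_all add: powr_diff powr_numeral power2_eq_square)
      show ?thesis
        using that assms 
        by (auto intro!: derivative_eq_intros simp: q_def exp_minus p) (simp add: divide_simps; algebra)
    qed
    show "((\<lambda>x. x powr (s - 1) / (s - 1) * (exp (-x) - 1 + x) - x powr s / (s * (s - 1)) * (1 - exp (-x))) \<longlongrightarrow> 0) (at_right 0)"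
      "((\<lambda>x. x powr (s - 1) / (s - 1) * (exp (-x) - 1 + x) - x powr s / (s * (s - 1)) * (1 - exp (-x))) \<longlongrightarrow> 0) at_top"
      using assms by real_asymp+
    show "x powr (s - 2) * (exp (- x) - 1 + x) \<ge> 0" for x
      using exp1[of x] by (intro mult_nonneg_nonneg) auto
  qed
  moreover have "integral {0<..} (\<lambda>x. - (q x / (s * (s - 1)))) = - Gamma (s - 1)"
    using qi assms by (simp add: integral_unique G)
  ultimately show "((\<lambda>x. x powr (s - 2) * (exp (- x) - 1 + x)) has_integral Gamma (s - 1)) {0<..}"
    by simp
qed

section \<open>Digamma reflection and partial fractions\<close>

lemma cosh_of_real: "cosh (of_real x :: complex) = of_real (cosh x)"
  by (simp add: cosh_field_def exp_of_real flip: of_real_minus)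

lemma sinh_of_real: "sinh (of_real x :: complex) = of_real (sinh x)"
  by (simp add: sinh_field_def exp_of_real flip: of_real_minus)

lemma cot_i_times: "cot (\<i> * of_real t) = - \<i> * of_real (cosh t / sinh t)"
proof -
  have "\<i> * (\<i> * complex_of_real t) = - of_real t" by simp
  then show ?thesis
    unfolding cot_def cos_conv_cosh sin_conv_sinh
    by (cases "t = 0"; simp add: cosh_of_real sinh_of_real field_simps)
qed

text \<open>Differentiate Gamma(z) Gamma(1 - z) = pi / sin(pi z) on both sides and cancel the common
  nonzero product.\<close>

lemma Digamma_reflection:
  fixes z :: complex
  assumes "z \<notin> \<int>"
  shows "Digamma (1 - z) - Digamma z = of_real pi * cot (of_real pi * z)"
proof -
  have nz: "z \<notin> \<int>\<^sub>\<le>\<^sub>0" "1 - z \<notin> \<int>\<^sub>\<le>\<^sub>0"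
    using assms Ints_diff[OF Ints_1, of "1 - z"] by (auto dest: nonpos_Ints_Int)
  have sin: "sin (of_real pi * z) \<noteq> 0"
    using assms by (auto simp: sin_eq_0 mult.commute)
  have "((\<lambda>z. Gamma z * Gamma (1 - z)) has_field_derivative
      Gamma z * Gamma (1 - z) * (Digamma z - Digamma (1 - z))) (at z)"
    using nz by (auto intro!: derivative_eq_intros simp: algebra_simps)
  moreover have "((\<lambda>z. of_real pi / sin (of_real pi * z)) has_field_derivative
      of_real pi / sin (of_real pi * z) * (- of_real pi * cot (of_real pi * z))) (at z)"
    using sin by (auto intro!: derivative_eq_intros simp: cot_def field_simps power2_eq_square)
  ultimately have "Gamma z * Gamma (1 - z) * (Digamma z - Digamma (1 - z)) =
      Gamma z * Gamma (1 - z) * (- of_real pi * cot (of_real pi * z))"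
    unfolding Gamma_reflection_complex by (rule DERIV_unique)
  moreover have "Gamma z * Gamma (1 - z) \<noteq> 0" using nz by (simp add: Gamma_eq_zero_iff)
  ultimately have "Digamma z - Digamma (1 - z) = - of_real pi * cot (of_real pi * z)"
    by (simp only: mult_cancel_left) auto
  then show ?thesis by (simp add: algebra_simps)
qed

text \<open>This is the partial fraction expansion of the cotangent at the imaginary point z = i x /
  (2 pi). It is read off from the series of psi(1 - z) - psi(1 + z) and the reflection formula, then
  rewritten with coth(x/2) / 2 = 1/(e^x - 1) + 1/2.\<close>

lemma planck_partial_fractions:
  assumes "x > (0::real)"
  shows "(\<lambda>n. 2 * x / (x\<^sup>2 + (2 * pi * real (Suc n))\<^sup>2)) sums (1 / (exp x - 1) - 1 / x + 1 / 2)"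
proof -
  define y where "y = x / (2 * pi)"
  define z where "z = \<i> * complex_of_real y"
  have y: "y > 0" using assms by (simp add: y_def)
  have z: "z \<notin> \<int>" using y by (auto simp: z_def complex_is_Int_iff)
  have [simp]: "z \<noteq> 0" using y by (simp add: z_def)
  have nz: "1 + z \<noteq> 0" "1 - z \<noteq> 0" by (simp_all add: z_def complex_eq_iff)
  \<comment> \<open>In the difference of the two digamma series, Euler's constant and the harmonic
    terms cancel.\<close>
  have "(\<lambda>k. inverse (1 + z + of_nat k) - inverse (1 - z + of_nat k)) sums (Digamma (1 - z) - Digamma (1 + z))"
    using sums_diff[OF summable_sums[OF summable_Digamma[OF nz(2)]] summable_sums[OF summable_Digamma[OF nz(1)]]]
    by (simp add: Digamma_def)
  also have "Digamma (1 - z) - Digamma (1 + z) = of_real pi * cot (of_real pi * z) - 1 / z"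
    using Digamma_reflection[OF z] Digamma_plus1[of z] by (simp add: add.commute)
  also have "\<dots> = - \<i> * of_real (pi * (cosh (x / 2) / sinh (x / 2)) - 1 / y)"
  proof -
    have "of_real pi * z = \<i> * of_real (x / 2)" by (simp add: z_def y_def)
    then have "cot (of_real pi * z) = - \<i> * of_real (cosh (x / 2) / sinh (x / 2))"
      by (simp only: cot_i_times)
    then show ?thesis using y by (simp add: z_def field_simps)
  qed
  also have "(\<lambda>k. inverse (1 + z + of_nat k) - inverse (1 - z + of_nat k)) =
      (\<lambda>k. - \<i> * of_real (2 * y / (y\<^sup>2 + (real (Suc k))\<^sup>2)))"
  proof
    fix k
    have "complex_of_real (y\<^sup>2 + (real (Suc k))\<^sup>2) \<noteq> 0"
      using y unfolding of_real_eq_0_iff by (smt (verit) zero_le_power2 zero_less_power2)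
    moreover have D: "(1 + z + of_nat k) * (1 - z + of_nat k) = of_real (y\<^sup>2 + (real (Suc k))\<^sup>2)"
      by (simp add: z_def power2_eq_square algebra_simps)
    ultimately have "1 + z + of_nat k \<noteq> 0" "1 - z + of_nat k \<noteq> 0" by auto
    then have "inverse (1 + z + of_nat k) - inverse (1 - z + of_nat k) =
        - 2 * z / ((1 + z + of_nat k) * (1 - z + of_nat k))"
      by (simp add: field_simps)
    also have "\<dots> = - \<i> * of_real (2 * y / (y\<^sup>2 + (real (Suc k))\<^sup>2))"
      unfolding D by (simp add: z_def)
    finally show "inverse (1 + z + of_nat k) - inverse (1 - z + of_nat k) =
        - \<i> * of_real (2 * y / (y\<^sup>2 + (real (Suc k))\<^sup>2))" .
  qed
  \<comment> \<open>Both sides are purely imaginary; multiplying by i makes them real, so that the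
    sum can be transferred to the reals.\<close>
  finally have "(\<lambda>k. \<i> * (- \<i> * of_real (2 * y / (y\<^sup>2 + (real (Suc k))\<^sup>2)))) sums
     (\<i> * (- \<i> * of_real (pi * (cosh (x / 2) / sinh (x / 2)) - 1 / y)))"
    by (rule sums_mult)
  then have "(\<lambda>k. complex_of_real (2 * y / (y\<^sup>2 + (real (Suc k))\<^sup>2))) sums
     (of_real (pi * (cosh (x / 2) / sinh (x / 2)) - 1 / y))"
    by (simp only: mult.assoc[symmetric]) simp
  then have "(\<lambda>k. 2 * y / (y\<^sup>2 + (real (Suc k))\<^sup>2)) sums (pi * (cosh (x / 2) / sinh (x / 2)) - 1 / y)"
    unfolding sums_of_real_iff .
  then have "(\<lambda>k. 1 / (2 * pi) * (2 * y / (y\<^sup>2 + (real (Suc k))\<^sup>2))) sums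
      (1 / (2 * pi) * (pi * (cosh (x / 2) / sinh (x / 2)) - 1 / y))"
    by (rule sums_mult)
  also have "1 / (2 * pi) * (pi * (cosh (x / 2) / sinh (x / 2)) - 1 / y) = 1 / (exp x - 1) - 1 / x + 1 / 2"
  proof -
    define e where "e = exp (x / 2)"
    have e: "e > 1" "exp x = e * e" using assms by (auto simp: e_def simp flip: exp_add)
    have "cosh (x / 2) = (e * e + 1) / (2 * e)" "sinh (x / 2) = (e * e - 1) / (2 * e)"
      unfolding cosh_field_def sinh_field_def exp_minus e_def[symmetric] using e(1) by (simp_all add: divide_simps)
    then have c: "cosh (x / 2) / sinh (x / 2) = (e * e + 1) / (e * e - 1)"
      using e(1) by simp
    have "e * e \<noteq> 1" using e by (metis less_1_mult less_irrefl)
    then show ?thesis unfolding c e(2) using assms by (simp add: y_def field_simps)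
  qed
  also have "(\<lambda>k. 1 / (2 * pi) * (2 * y / (y\<^sup>2 + (real (Suc k))\<^sup>2))) =
      (\<lambda>k. 2 * x / (x\<^sup>2 + (2 * pi * real (Suc k))\<^sup>2))"
  proof
    fix k
    have "(2 * pi)\<^sup>2 * (y\<^sup>2 + (real (Suc k))\<^sup>2) = x\<^sup>2 + (2 * pi * real (Suc k))\<^sup>2"
      unfolding distrib_left power_mult_distrib[symmetric] by (simp add: y_def)
    moreover have "1 / (2 * pi) * (2 * y / D) = 2 * x / ((2 * pi)\<^sup>2 * D)" for D
      by (simp add: y_def power2_eq_square)
    ultimately show "1 / (2 * pi) * (2 * y / (y\<^sup>2 + (real (Suc k))\<^sup>2)) = 2 * x / (x\<^sup>2 + (2 * pi * real (Suc k))\<^sup>2)"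
      by (simp only:)
  qed
  finally show ?thesis .
qed

section \<open>Mellin transforms\<close>

text \<open>Termwise integration under a summable bound on the L1 norms. The functions are extended
  by zero outside \<open>S\<close>, so that the theorem for Lebesgue integrals over the whole line
  applies, and the result is translated back.\<close>

lemma absolutely_integrable_sums:
  fixes f :: "nat \<Rightarrow> real \<Rightarrow> complex"
  assumes "\<And>n. f n absolutely_integrable_on S"
    and "\<And>x. x \<in> S \<Longrightarrow> summable (\<lambda>n. norm (f n x))"
    and "summable (\<lambda>n. integral S (\<lambda>x. norm (f n x)))"
    and "\<And>x. x \<in> S \<Longrightarrow> (\<lambda>n. f n x) sums g x"
  shows "g absolutely_integrable_on S" and "(\<lambda>n. integral S (f n)) sums integral S g"
proof -
  define F where "F = (\<lambda>n x. indicator S x *\<^sub>R f n x)"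
  have F: "integrable lebesgue (F n)" for n
    using assms(1)[of n] by (simp add: set_integrable_def F_def)
  have nF: "(\<lambda>x. norm (f n x)) absolutely_integrable_on S" for n
    using assms(1) by (rule absolutely_integrable_norm[unfolded o_def])
  have S: "AE x in lebesgue. summable (\<lambda>n. norm (F n x))"
    using assms(2) by (auto simp: F_def indicator_def)
  have "(\<integral>x. norm (F n x) \<partial>lebesgue) = integral S (\<lambda>x. norm (f n x))" for n
    using set_lebesgue_integral_eq_integral(2)[OF nF[of n]]
    by (simp add: set_lebesgue_integral_def F_def)
  then have I: "summable (\<lambda>n. \<integral>x. norm (F n x) \<partial>lebesgue)"
    using assms(3) by simp
  have g: "(\<Sum>n. F n x) = indicator S x *\<^sub>R g x" for x
    using assms(4)[of x] by (auto simp: F_def indicator_def sums_iff)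
  show abs: "g absolutely_integrable_on S"
    using integrable_suminf[OF F S I] by (simp add: g set_integrable_def)
  have "(\<lambda>n. integral\<^sup>L lebesgue (F n)) sums (\<integral>x. (\<Sum>n. F n x) \<partial>lebesgue)"
    by (rule sums_integral[OF F S I])
  then show "(\<lambda>n. integral S (f n)) sums integral S g"
    using set_lebesgue_integral_eq_integral(2)[OF abs]
      set_lebesgue_integral_eq_integral(2)[OF assms(1)]
    unfolding g by (simp add: F_def set_lebesgue_integral_def)
qed

lemma absolutely_integrable_of_real:
  fixes f :: "real \<Rightarrow> real"
  assumes "f absolutely_integrable_on S"
  shows "(\<lambda>x. complex_of_real (f x)) absolutely_integrable_on S"
  using absolutely_integrable_linear[OF assms bounded_linear_of_real] by (simp add: o_def)

section \<open>Mellin transforms: convergence in strips, holomorphy, termwise summation\<close>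

definition mellin_integrand :: "(real \<Rightarrow> complex) \<Rightarrow> complex \<Rightarrow> real \<Rightarrow> complex" where
  "mellin_integrand g s x = of_real x powr (s - 1) * g x"

definition mellin :: "(real \<Rightarrow> complex) \<Rightarrow> complex \<Rightarrow> complex" where
  "mellin g s = integral {0<..} (mellin_integrand g s)"

lemma norm_mellin_integrand:
  "x > 0 \<Longrightarrow> norm (mellin_integrand g s x) = x powr (Re s - 1) * norm (g x)"
  by (simp add: mellin_integrand_def norm_mult norm_powr_real_powr)

text \<open>For x >= 1 the larger exponent dominates, for x < 1 the smaller one, so the sum of the
  two is a majorant on the whole half line. It does not depend on s within the strip; this yields
  both interpolation and uniform convergence.\<close>

lemma norm_mellin_integrand_le:
  assumes "x > 0" "Re a \<le> Re s" "Re s \<le> Re b"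
  shows "norm (mellin_integrand g s x) \<le> norm (mellin_integrand g a x) + norm (mellin_integrand g b x)"
proof -
  have "x powr (Re s - 1) \<le> x powr (Re a - 1) + x powr (Re b - 1)"
  proof (cases "x \<ge> 1")
    case True
    then have "x powr (Re s - 1) \<le> x powr (Re b - 1)"
      using assms by (intro powr_mono) auto
    then show ?thesis by (smt (verit) powr_ge_zero)
  next
    case False
    then have "x powr (Re s - 1) \<le> x powr (Re a - 1)"
      using assms by (intro powr_mono') auto
    then show ?thesis by (smt (verit) powr_ge_zero)
  qed
  from mult_right_mono[OF this, of "norm (g x)"] show ?thesis
    using assms by (simp add: norm_mellin_integrand algebra_simps)
qed

lemma continuous_on_mellin_integrand:
  assumes "continuous_on {0<..} g"
  shows "continuous_on {0<..} (mellin_integrand g s)"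
  unfolding mellin_integrand_def by (intro continuous_intros assms) (auto simp: complex_nonpos_Reals_iff)

lemma absolutely_integrable_mellin_interpolate:
  assumes "continuous_on {0<..} g"
    and "mellin_integrand g a absolutely_integrable_on {0<..}"
    and "mellin_integrand g b absolutely_integrable_on {0<..}"
    and "Re a \<le> Re s" "Re s \<le> Re b"
  shows "mellin_integrand g s absolutely_integrable_on {0<..}"
proof (rule measurable_bounded_by_integrable_imp_absolutely_integrable)
  show "mellin_integrand g s \<in> borel_measurable (lebesgue_on {0<..})"
    by (intro continuous_imp_measurable_on_sets_lebesgue continuous_on_mellin_integrand assms) auto
  show "(\<lambda>x. norm (mellin_integrand g a x) + norm (mellin_integrand g b x)) integrable_on {0<..}"
    using assms(2,3) by (intro integrable_add) (auto simp: absolutely_integrable_on_def)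
qed (use norm_mellin_integrand_le assms in auto)

text \<open>Integrals over compact intervals are holomorphic by differentiation under the integral
  sign. The tails are bounded by the tails of the s-independent majorant \<open>H\<close>, so these
  integrals converge uniformly on closed discs and the limit is holomorphic.\<close>

lemma holomorphic_mellin:
  assumes g: "continuous_on {0<..} g"
    and a: "mellin_integrand g a absolutely_integrable_on {0<..}"
    and b: "mellin_integrand g b absolutely_integrable_on {0<..}"
  shows "mellin g holomorphic_on {s. Re a < Re s \<and> Re s < Re b}"
proof -
  define U where "U = {s. Re a < Re s \<and> Re s < Re b}"
  define K where "K = (\<lambda>n::nat. {1 / Suc n .. real (Suc n)})"
  define H where "H = (\<lambda>x. norm (mellin_integrand g a x) + norm (mellin_integrand g b x))"
  have U: "open U" "convex U"
  proof -
    have "U = {s. Re a < Re s} \<inter> {s. Re s < Re b}" by (auto simp: U_def)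
    then show "open U" "convex U"
      by (auto intro!: open_Int open_halfspace_Re_gt open_halfspace_Re_lt convex_Int
          convex_halfspace_Re_gt convex_halfspace_Re_lt)
  qed
  have K: "K n \<subseteq> {0<..}" for n
    by (auto simp: K_def intro: less_le_trans[of 0 "1 / (1 + real n)"])
  have Habs: "H absolutely_integrable_on {0<..}"
    unfolding H_def using a b
    by (intro set_integral_add absolutely_integrable_norm[unfolded o_def])
  have Hint: "H integrable_on {0<..}" using Habs by (rule set_lebesgue_integral_eq_integral)
  have HintK: "H integrable_on K n" for n
    by (rule set_lebesgue_integral_eq_integral(1), rule set_integrable_subset[OF Habs _ K]) (auto simp: K_def)
  have abs: "mellin_integrand g s absolutely_integrable_on {0<..}" if "s \<in> U" for s
    by (rule absolutely_integrable_mellin_interpolate[OF g a b]) (use that in \<open>auto simp: U_def\<close>)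
  have int: "mellin_integrand g s integrable_on {0<..}" if "s \<in> U" for s
    using abs[OF that] by (rule set_lebesgue_integral_eq_integral)
  have intK: "mellin_integrand g s integrable_on K n" if "s \<in> U" for s n
    by (rule set_lebesgue_integral_eq_integral(1), rule set_integrable_subset[OF abs[OF that] _ K])
       (auto simp: K_def)
  have lim: "(\<lambda>n. integral (K n) H) \<longlonglongrightarrow> integral {0<..} H"
    unfolding K_def by (rule tendsto_integral_exhaustion[OF Habs])
  \<comment> \<open>The error is the integral over the complement of \<open>K n\<close>, where
    \<open>H\<close> dominates; the resulting bound is uniform in s.\<close>
  have bound: "norm (integral (K n) (mellin_integrand g s) - mellin g s)
                 \<le> integral {0<..} H - integral (K n) H" if "s \<in> U" for s n
  proof -
    let ?f = "mellin_integrand g s"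
    have 1: "(?f has_integral (mellin g s - integral (K n) ?f)) ({0<..} - K n)"
      unfolding mellin_def
      by (rule has_integral_setdiff) (use int[OF that] intK[OF that] K in auto)
    have 2: "(H has_integral (integral {0<..} H - integral (K n) H)) ({0<..} - K n)"
      by (rule has_integral_setdiff) (use Hint HintK K in auto)
    have "norm (integral ({0<..} - K n) ?f) \<le> integral ({0<..} - K n) H"
    proof (rule integral_norm_bound_integral)
      show "norm (?f x) \<le> H x" if "x \<in> {0<..} - K n" for x
        unfolding H_def by (rule norm_mellin_integrand_le) (use that \<open>s \<in> U\<close> in \<open>auto simp: U_def\<close>)
    qed (use 1 2 in blast)+
    then show ?thesis
      using 1 2 by (simp add: integral_unique norm_minus_commute)
  qed
  have "mellin g holomorphic_on U"
  proof (rule holomorphic_uniform_sequence[OF \<open>open U\<close>])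
    fix n
    have pos: "t > 0" if "t \<in> K n" for t using K[of n] that by auto
    have cont: "continuous_on (U \<times> K n) (\<lambda>(s, t). of_real (ln t) * of_real t powr (s - 1) * g t)"
      unfolding case_prod_unfold
      by (intro continuous_intros continuous_on_compose2[OF g])
         (auto simp: complex_nonpos_Reals_iff dest: pos)
    have "(\<lambda>s. integral (cbox (1 / Suc n) (real (Suc n))) (mellin_integrand g s)) holomorphic_on U"
    proof (rule leibniz_rule_holomorphic[OF _ _ _ \<open>convex U\<close>])
      show "((\<lambda>s. mellin_integrand g s t) has_field_derivative of_real (ln t) * of_real t powr (s - 1) * g t) (at s within U)"
        if "t \<in> cbox (1 / Suc n) (real (Suc n))" for s t
      proof -
        have "t > 0" using pos that by (simp add: K_def)
        then show ?thesis unfolding mellin_integrand_def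
          by (auto intro!: derivative_eq_intros simp: powr_def Ln_of_real)
      qed
    qed (use cont intK in \<open>simp_all add: K_def\<close>)
    then show "(\<lambda>s. integral (K n) (mellin_integrand g s)) holomorphic_on U"
      by (simp add: K_def)
  next
    fix s assume "s \<in> U"
    then obtain d where d: "d > 0" "cball s d \<subseteq> U" using \<open>open U\<close> open_contains_cball by blast
    have "uniform_limit (cball s d) (\<lambda>n s. integral (K n) (mellin_integrand g s)) (mellin g) sequentially"
    proof (rule uniform_limitI)
      fix e :: real assume "e > 0"
      have "(\<lambda>n. integral {0<..} H - integral (K n) H) \<longlonglongrightarrow> 0"
        using tendsto_diff[OF tendsto_const lim, of "integral {0<..} H"] by simp
      from order_tendstoD(2)[OF this \<open>e > 0\<close>]
      show "\<forall>\<^sub>F n in sequentially. \<forall>x\<in>cball s d. dist (integral (K n) (mellin_integrand g x)) (mellin g x) < e"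
        by eventually_elim (use d bound in \<open>auto simp: dist_norm intro: le_less_trans\<close>)
    qed
    then show "\<exists>d>0. cball s d \<subseteq> U \<and>
        uniform_limit (cball s d) (\<lambda>n s. integral (K n) (mellin_integrand g s)) (mellin g) sequentially"
      using d by blast
  qed
  then show ?thesis by (simp add: U_def)
qed

text \<open>For x > 0 the modulus of x^(s-1) is x^(Re s - 1). Hence the L1 norm of the integrand at
  s is a Mellin transform at a real point, and an explicit formula there computes the norm.\<close>

lemma mellin_of_real:
  assumes "\<And>x. x > 0 \<Longrightarrow> G x \<ge> 0"
    and "mellin_integrand (\<lambda>x. of_real (G x)) s absolutely_integrable_on {0<..}"
  shows "mellin (\<lambda>x. of_real (G x)) (of_real (Re s))
           = of_real (integral {0<..} (\<lambda>x. norm (mellin_integrand (\<lambda>x. of_real (G x)) s x)))"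
proof -
  let ?g = "\<lambda>x. complex_of_real (G x)"
  have "(\<lambda>x. norm (mellin_integrand ?g s x)) integrable_on {0<..}"
    using assms(2) by (auto simp: absolutely_integrable_on_def)
  then have "((\<lambda>x. complex_of_real (norm (mellin_integrand ?g s x))) has_integral
      of_real (integral {0<..} (\<lambda>x. norm (mellin_integrand ?g s x)))) {0<..}"
    by (intro has_integral_of_real integrable_integral)
  moreover have "complex_of_real (norm (mellin_integrand ?g s x)) = mellin_integrand ?g (of_real (Re s)) x"
    if "x > 0" for x
  proof -
    have "complex_of_real x powr (of_real (Re s) - 1) = of_real (x powr (Re s - 1))"
      using that powr_of_real[of x "Re s - 1"] by simp
    then show ?thesis
      using that assms(1)[OF that] unfolding norm_mellin_integrand[OF that] by (simp add: mellin_integrand_def)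
  qed
  ultimately show ?thesis unfolding mellin_def
    by (intro integral_unique) (auto elim!: has_integral_eq[rotated])
qed

text \<open>Nonnegativity makes \<open>c n\<close> exactly the L1 norm of the n-th integrand at s,
  so summability of \<open>c\<close> is the bound required for integrating term by term.\<close>

lemma mellin_sums:
  fixes G :: "nat \<Rightarrow> real \<Rightarrow> real"
  assumes "\<And>n x. x > 0 \<Longrightarrow> G n x \<ge> 0"
    and int: "\<And>n. mellin_integrand (\<lambda>x. of_real (G n x)) s absolutely_integrable_on {0<..}"
    and "\<And>n. mellin (\<lambda>x. of_real (G n x)) (of_real (Re s)) = of_real (c n)"
    and "summable c"
    and G: "\<And>x. x > 0 \<Longrightarrow> (\<lambda>n. G n x) sums H x"
  shows "mellin_integrand (\<lambda>x. of_real (H x)) s absolutely_integrable_on {0<..}"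
    and "(\<lambda>n. mellin (\<lambda>x. of_real (G n x)) s) sums mellin (\<lambda>x. of_real (H x)) s"
proof -
  have sm: "summable (\<lambda>n. norm (mellin_integrand (\<lambda>x. of_real (G n x)) s x))" if "x \<in> {0<..}" for x
    using that assms(1) sums_summable[OF G] by (simp add: norm_mellin_integrand summable_mult)
  have "(\<lambda>n. integral {0<..} (\<lambda>x. norm (mellin_integrand (\<lambda>x. of_real (G n x)) s x))) = c"
    using mellin_of_real[OF assms(1) int] unfolding assms(3) of_real_eq_iff by (intro ext) simp
  then have c: "summable (\<lambda>n. integral {0<..} (\<lambda>x. norm (mellin_integrand (\<lambda>x. of_real (G n x)) s x)))"
    using \<open>summable c\<close> by simp
  have lim: "(\<lambda>n. mellin_integrand (\<lambda>x. of_real (G n x)) s x) sums mellin_integrand (\<lambda>x. of_real (H x)) s x"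
    if "x \<in> {0<..}" for x
    using G that unfolding mellin_integrand_def by (intro sums_mult sums_of_real) auto
  show "mellin_integrand (\<lambda>x. of_real (H x)) s absolutely_integrable_on {0<..}"
    by (rule absolutely_integrable_sums(1)[OF int sm c lim])
  show "(\<lambda>n. mellin (\<lambda>x. of_real (G n x)) s) sums mellin (\<lambda>x. of_real (H x)) s"
    unfolding mellin_def by (rule absolutely_integrable_sums(2)[OF int sm c lim])
qed

section \<open>Explicit Mellin transforms\<close>

lemma mellin_exp:
  assumes "Re s > 0" "a > 0"
  shows "mellin_integrand (\<lambda>x. of_real (exp (- a * x))) s absolutely_integrable_on {0<..}"
    and "mellin (\<lambda>x. of_real (exp (- a * x))) s = Gamma s * of_real a powr (- s)"
proof -
  let ?f = "mellin_integrand (\<lambda>x. of_real (exp (- x))) s"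
  let ?fa = "mellin_integrand (\<lambda>x. of_real (exp (- a * x))) s"
  have eq: "?f = (\<lambda>t. complex_of_real t powr (s - 1) / of_real (exp t))"
    by (auto simp: mellin_integrand_def exp_minus field_simps)
  have img: "(\<lambda>x. a * x) ` {0<..} = {0<..}"
    using assms by (auto simp: image_iff intro!: bexI[of _ "_ / a"])
  have "(\<lambda>x. \<bar>a\<bar> *\<^sub>R ?f (a * x)) absolutely_integrable_on {0<..} \<and>
        integral {0<..} (\<lambda>x. \<bar>a\<bar> *\<^sub>R ?f (a * x)) = Gamma s
        \<longleftrightarrow> ?f absolutely_integrable_on (\<lambda>x. a * x) ` {0<..} \<and> integral ((\<lambda>x. a * x) ` {0<..}) ?f = Gamma s"
    by (rule has_absolute_integral_change_of_variables_real)
       (use assms in \<open>auto intro!: derivative_eq_intros simp: inj_on_def\<close>)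
  moreover have "?f absolutely_integrable_on {0<..}" "integral {0<..} ?f = Gamma s"
    using absolutely_integrable_Gamma_integral'[OF assms(1)] Gamma_integral_complex'[OF assms(1)]
    unfolding eq by (auto intro: integral_unique)
  ultimately have *: "(\<lambda>x. \<bar>a\<bar> *\<^sub>R ?f (a * x)) absolutely_integrable_on {0<..}"
    "integral {0<..} (\<lambda>x. \<bar>a\<bar> *\<^sub>R ?f (a * x)) = Gamma s"
    unfolding img by auto
  \<comment> \<open>The substitution x -> a x in Euler's integral produces a (a x)^(s-1);
    multiplying by a^(-s) reduces this to x^(s-1).\<close>
  have **: "of_real a powr (- s) * (\<bar>a\<bar> *\<^sub>R ?f (a * x)) = ?fa x" if "x \<in> {0<..}" for x
    using that assms
    by (simp add: mellin_integrand_def scaleR_conv_of_real powr_times_real powr_diff powr_minus field_simps)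
  have "(\<lambda>x. of_real a powr (- s) * (\<bar>a\<bar> *\<^sub>R ?f (a * x))) absolutely_integrable_on {0<..}"
    using *(1) by (rule set_integrable_mult_right)
  also have "?this \<longleftrightarrow> ?fa absolutely_integrable_on {0<..}"
    by (rule set_integrable_cong) (use ** in auto)
  finally show "?fa absolutely_integrable_on {0<..}" .
  have "integral {0<..} ?fa = integral {0<..} (\<lambda>x. of_real a powr (- s) * (\<bar>a\<bar> *\<^sub>R ?f (a * x)))"
    by (rule integral_cong) (use ** in auto)
  also have "\<dots> = of_real a powr (- s) * Gamma s"
    using *(2) by (simp only: integral_mult_right)
  finally show "mellin (\<lambda>x. of_real (exp (- a * x))) s = Gamma s * of_real a powr (- s)"
    by (simp add: mellin_def)
qed

text \<open>Expand 1/(e^x - 1) as the geometric series of e^(-(n+1) x) and transform each term; the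
  norms are the terms of a convergent Dirichlet series at Re s > 1.\<close>

lemma mellin_planck:
  assumes "Re s > 1"
  shows "mellin_integrand (\<lambda>x. of_real (1 / (exp x - 1))) s absolutely_integrable_on {0<..}"
    and "mellin (\<lambda>x. of_real (1 / (exp x - 1))) s = Gamma s * (\<Sum>n. 1 / of_nat (Suc n) powr s)"
proof -
  define c where "c = (\<lambda>n. Gamma (Re s) * real (Suc n) powr (- Re s))"
  define G where "G = (\<lambda>n x. exp (- real (Suc n) * x))"
  have c: "summable c" unfolding c_def
    using assms by (intro summable_mult) (simp add: summable_real_powr_iff summable_Suc_iff[of "\<lambda>n. real n powr (- Re s)"] del: of_nat_Suc)
  have int: "mellin_integrand (\<lambda>x. of_real (G n x)) s absolutely_integrable_on {0<..}" for n
    unfolding G_def using assms by (intro mellin_exp) auto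
  have mel: "mellin (\<lambda>x. of_real (G n x)) (of_real (Re s)) = of_real (c n)" for n
  proof -
    have "mellin (\<lambda>x. of_real (G n x)) (of_real (Re s)) =
        Gamma (of_real (Re s)) * of_real (real (Suc n)) powr (- of_real (Re s))"
      unfolding G_def using assms by (intro mellin_exp) auto
    also have "complex_of_real (real (Suc n)) powr (- of_real (Re s)) = of_real (real (Suc n) powr (- Re s))"
      using powr_of_real[of "real (Suc n)" "- Re s"] by simp
    finally show ?thesis by (simp add: c_def Gamma_complex_of_real)
  qed
  have G: "(\<lambda>n. G n x) sums (1 / (exp x - 1))" if "x > 0" for x
  proof -
    have "(\<lambda>n. exp (-x) ^ Suc n) sums (exp (-x) * (1 / (1 - exp (-x))))"
      unfolding power_Suc using that by (intro sums_mult geometric_sums) auto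
    also have "(\<lambda>n. exp (-x) ^ Suc n) = (\<lambda>n. G n x)"
      by (intro ext) (simp only: G_def exp_of_nat_mult[symmetric] mult_minus_left mult_minus_right)
    also have "exp (-x) * (1 / (1 - exp (-x))) = 1 / (exp x - 1)"
      using that by (simp add: exp_minus field_simps)
    finally show ?thesis .
  qed
  note sums = mellin_sums[OF _ int mel c G]
  show "mellin_integrand (\<lambda>x. of_real (1 / (exp x - 1))) s absolutely_integrable_on {0<..}"
    by (rule sums(1)) (auto simp: G_def)
  have "(\<lambda>n. mellin (\<lambda>x. of_real (G n x)) s) sums mellin (\<lambda>x. of_real (1 / (exp x - 1))) s"
    by (rule sums(2)) (auto simp: G_def)
  also have "(\<lambda>n. mellin (\<lambda>x. of_real (G n x)) s) = (\<lambda>n. Gamma s * (1 / of_nat (Suc n) powr s))"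
  proof
    fix n
    have "mellin (\<lambda>x. of_real (G n x)) s = Gamma s * of_real (real (Suc n)) powr (- s)"
      unfolding G_def using assms by (intro mellin_exp) auto
    then show "mellin (\<lambda>x. of_real (G n x)) s = Gamma s * (1 / of_nat (Suc n) powr s)"
      by (simp only: powr_minus of_real_of_nat_eq inverse_eq_divide)
  qed
  finally have S: "(\<lambda>n. Gamma s * (1 / of_nat (Suc n) powr s)) sums mellin (\<lambda>x. of_real (1 / (exp x - 1))) s" .
  \<comment> \<open>Pulling \<open>Gamma s\<close> out of the infinite sum requires summability of
    the Dirichlet series itself, which follows by cancelling this nonzero factor.\<close>
  have "Gamma s \<noteq> 0" using assms by (auto simp: Gamma_eq_zero_iff elim!: nonpos_Ints_cases)
  with summable_mult_D[OF sums_summable[OF S]]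
  have "summable (\<lambda>n. 1 / complex_of_nat (Suc n) powr s)" .
  then show "mellin (\<lambda>x. of_real (1 / (exp x - 1))) s = Gamma s * (\<Sum>n. 1 / of_nat (Suc n) powr s)"
    by (rule trans[OF sums_unique[OF S] suminf_mult])
qed

text \<open>The substitution t = x^2 / (x^2 + c^2) turns the integral into Beta((1 + s)/2, (1 -
  s)/2). The arguments add up to 1, so the reflection formula for Gamma evaluates it as pi / cos(pi
  s / 2).\<close>

lemma mellin_rational:
  assumes "-1 < s" "s < 1" "c > 0"
  shows "mellin_integrand (\<lambda>x. of_real (2 * x / (x\<^sup>2 + c\<^sup>2))) (of_real s) absolutely_integrable_on {0<..}"
    and "mellin (\<lambda>x. of_real (2 * x / (x\<^sup>2 + c\<^sup>2))) (of_real s) = of_real (c powr (s - 1) * pi / cos (pi * s / 2))"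
proof -
  define a b where "a = (1 + s) / 2" and "b = (1 - s) / 2"
  define f where "f = (\<lambda>t. t powr (a - 1) * (1 - t) powr (b - 1))"
  \<comment> \<open>\<open>g\<close> is the substitution, \<open>h\<close> its derivative,
    \<open>f\<close> the Beta integrand and \<open>F\<close> the Mellin integrand.\<close>
  define g where "g = (\<lambda>x. x\<^sup>2 / (x\<^sup>2 + c\<^sup>2))"
  define h where "h = (\<lambda>x. 2 * x * c\<^sup>2 / (x\<^sup>2 + c\<^sup>2)\<^sup>2)"
  define F where "F = (\<lambda>x. 2 * x powr s / (x\<^sup>2 + c\<^sup>2))"
  have pos: "x\<^sup>2 + c\<^sup>2 > 0" for x using assms by (simp add: add_nonneg_pos)
  have ab: "a > 0" "b > 0" using assms by (auto simp: a_def b_def)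
  have img: "g ` {0<..} = {0<..<1}"
  proof (intro equalityI subsetI)
    fix y assume "y \<in> g ` {0<..}"
    then obtain x where "x > 0" "y = g x" by auto
    then show "y \<in> {0<..<1}" using pos[of x] assms by (auto simp: g_def)
  next
    fix t :: real assume t: "t \<in> {0<..<1}"
    \<comment> \<open>The preimage comes from solving t = x^2 / (x^2 + c^2) for x.\<close>
    have "g (c * sqrt (t / (1 - t))) = t" using t assms
      by (simp add: g_def power_mult_distrib divide_simps) (simp add: algebra_simps)
    moreover have "c * sqrt (t / (1 - t)) \<in> {0<..}" using t assms by auto
    ultimately show "t \<in> g ` {0<..}" by (metis image_eqI)
  qed
  have inj: "inj_on g {0<..}"
  proof (rule inj_onI)
    fix x y assume "x \<in> {0<..}" "y \<in> {0<..}" "g x = g y"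
    moreover from this have "x\<^sup>2 = y\<^sup>2"
      using pos[of x] pos[of y] assms by (simp add: g_def frac_eq_eq algebra_simps)
    ultimately show "x = y" by (simp add: power2_eq_iff)
  qed
  have "(f has_integral Beta a b) {0<..<1}"
    using has_integral_Beta_real[OF ab] by (simp add: has_integral_Icc_iff_Ioo f_def)
  moreover from this have "f absolutely_integrable_on {0<..<1}"
    by (intro nonnegative_absolutely_integrable_1) (auto simp: f_def)
  moreover have "(\<lambda>x. \<bar>h x\<bar> * f (g x)) absolutely_integrable_on {0<..} \<and>
        integral {0<..} (\<lambda>x. \<bar>h x\<bar> * f (g x)) = Beta a b
        \<longleftrightarrow> f absolutely_integrable_on g ` {0<..} \<and> integral (g ` {0<..}) f = Beta a b"
    by (rule has_absolute_integral_change_of_variables_1'[OF _ _ inj])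
       (use pos less_imp_neq[OF pos] in \<open>auto simp: g_def h_def power2_eq_square algebra_simps intro!: derivative_eq_intros\<close>)
  ultimately have *: "(\<lambda>x. \<bar>h x\<bar> * f (g x)) absolutely_integrable_on {0<..}"
    "integral {0<..} (\<lambda>x. \<bar>h x\<bar> * f (g x)) = Beta a b"
    unfolding img by (auto intro: integral_unique)
  \<comment> \<open>Both sides are positive, so it suffices to compare logarithms; the identity
    becomes linear in ln x, ln c and ln D.\<close>
  have **: "c powr (s - 1) * (\<bar>h x\<bar> * f (g x)) = F x" if "x \<in> {0<..}" for x
  proof -
    define D where "D = x\<^sup>2 + c\<^sup>2"
    have D: "D > 0" "x > 0" using pos that by (auto simp: D_def)
    have 1: "1 - g x = c\<^sup>2 / D" using D by (simp add: g_def D_def field_simps)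
    have 2: "f (g x) = (x\<^sup>2 / D) powr (a - 1) * (c\<^sup>2 / D) powr (b - 1)"
      unfolding f_def 1 by (simp add: g_def D_def)
    have pos: "c powr (s - 1) > 0" "\<bar>h x\<bar> > 0" "(x\<^sup>2 / D) powr (a - 1) > 0" "(c\<^sup>2 / D) powr (b - 1) > 0"
      using D assms unfolding h_def D_def[symmetric] by auto
    have "\<bar>h x\<bar> = 2 * x * c\<^sup>2 / D\<^sup>2"
      using D unfolding h_def D_def[symmetric] by simp
    then have "ln \<bar>h x\<bar> = ln 2 + ln x + 2 * ln c - 2 * ln D"
      using D assms by (simp add: ln_mult ln_div ln_realpow)
    moreover have "ln ((x\<^sup>2 / D) powr (a - 1)) = (a - 1) * (2 * ln x - ln D)"
      "ln ((c\<^sup>2 / D) powr (b - 1)) = (b - 1) * (2 * ln c - ln D)"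
      using D assms by (simp_all add: ln_powr ln_div ln_realpow)
    moreover have "ln (F x) = ln 2 + s * ln x - ln D"
      using D assms unfolding F_def D_def[symmetric] by (simp add: ln_mult ln_div ln_powr)
    moreover have "ln (c powr (s - 1) * (\<bar>h x\<bar> * f (g x))) = (s - 1) * ln c +
        (ln \<bar>h x\<bar> + (ln ((x\<^sup>2 / D) powr (a - 1)) + ln ((c\<^sup>2 / D) powr (b - 1))))"
      unfolding 2 using pos assms by (simp only: ln_mult_pos ln_powr mult_pos_pos)
    ultimately have "ln (c powr (s - 1) * (\<bar>h x\<bar> * f (g x))) = ln (F x)"
      by (simp only: a_def b_def) (simp add: field_simps)
    moreover have "c powr (s - 1) * (\<bar>h x\<bar> * f (g x)) > 0" "F x > 0"
      using pos D unfolding 2 F_def D_def[symmetric] by (auto intro!: mult_pos_pos divide_pos_pos)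
    ultimately show ?thesis by simp
  qed
  have "(\<lambda>x. c powr (s - 1) * (\<bar>h x\<bar> * f (g x))) absolutely_integrable_on {0<..}"
    using *(1) by (rule set_integrable_mult_right)
  also have "?this \<longleftrightarrow> F absolutely_integrable_on {0<..}"
    by (rule set_integrable_cong) (use ** in auto)
  finally have Fabs: "F absolutely_integrable_on {0<..}" .
  have "integral {0<..} F = integral {0<..} (\<lambda>x. c powr (s - 1) * (\<bar>h x\<bar> * f (g x)))"
    by (rule integral_cong) (use ** in auto)
  also have "\<dots> = c powr (s - 1) * Beta a b"
    using *(2) by (simp only: integral_mult_right)
  also have "Beta a b = pi / cos (pi * s / 2)"
  proof -
    have "complex_of_real (Gamma a * Gamma (1 - a)) = of_real (pi / sin (pi * a))"
      using Gamma_reflection_complex[of "of_real a"] Gamma_complex_of_real[of a]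
        Gamma_complex_of_real[of "1 - a"] sin_of_real[of "pi * a", where ?'a = complex]
      by simp
    then have "Gamma a * Gamma (1 - a) = pi / sin (pi * a)" using of_real_eq_iff by blast
    moreover have "1 - a = b" "a + b = 1" by (simp_all add: a_def b_def field_simps)
    moreover have "sin (pi * a) = cos (pi * s / 2)"
      using sin_cos_eq[of "pi * a"] by (simp add: a_def field_simps)
    ultimately show ?thesis by (simp add: Beta_def)
  qed
  finally have Fint: "(F has_integral c powr (s - 1) * pi / cos (pi * s / 2)) {0<..}"
    using set_lebesgue_integral_eq_integral(1)[OF Fabs] by (simp add: has_integral_iff)
  have eq: "complex_of_real (F x) = mellin_integrand (\<lambda>x. of_real (2 * x / (x\<^sup>2 + c\<^sup>2))) (of_real s) x"
    if "x \<in> {0<..}" for x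
  proof -
    have "x powr (s - 1) * x = x powr s" using that by (simp add: powr_diff)
    then have "F x = x powr (s - 1) * (2 * x / (x\<^sup>2 + c\<^sup>2))" unfolding F_def by (simp add: mult_ac)
    then show ?thesis
      using that powr_of_real[of x "s - 1"] by (simp add: mellin_integrand_def)
  qed
  have "(\<lambda>x. complex_of_real (F x)) absolutely_integrable_on {0<..}"
    using Fabs by (rule absolutely_integrable_of_real)
  also have "?this \<longleftrightarrow> mellin_integrand (\<lambda>x. of_real (2 * x / (x\<^sup>2 + c\<^sup>2))) (of_real s) absolutely_integrable_on {0<..}"
    by (rule set_integrable_cong) (use eq in auto)
  finally show "mellin_integrand (\<lambda>x. of_real (2 * x / (x\<^sup>2 + c\<^sup>2))) (of_real s) absolutely_integrable_on {0<..}" .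
  show "mellin (\<lambda>x. of_real (2 * x / (x\<^sup>2 + c\<^sup>2))) (of_real s) = of_real (c powr (s - 1) * pi / cos (pi * s / 2))"
    unfolding mellin_def by (rule integral_unique, rule has_integral_eq[OF eq has_integral_of_real[OF Fint]])
qed

section \<open>Analytic continuation and functional equation of zeta\<close>

text \<open>Both 1/(e^x - 1) and e^(-x) (1/x + 1/2) are 1/x - 1/2 + O(x) near 0, so the difference
  is O(x). The factor e^(-x) keeps exponential decay at infinity and makes the subtracted transforms
  Gamma functions.\<close>

definition zeta_kernel :: "real \<Rightarrow> complex" where
  "zeta_kernel x = of_real (1 / (exp x - 1) - exp (- x) * (1 / x + 1 / 2))"

lemma continuous_on_zeta_kernel: "continuous_on {0<..} zeta_kernel"
  unfolding zeta_kernel_def by (intro continuous_intros) auto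

lemma mellin_integrand_zeta_kernel:
  assumes "x > 0"
  shows "mellin_integrand zeta_kernel s x = mellin_integrand (\<lambda>x. of_real (1 / (exp x - 1))) s x
           - mellin_integrand (\<lambda>x. of_real (exp (- 1 * x))) (s - 1) x
           - mellin_integrand (\<lambda>x. of_real (exp (- 1 * x))) s x / 2"
proof -
  have "of_real x powr (s - 1 - 1) = of_real x powr (s - 1) / of_real x"
    by (subst powr_diff) (use assms in simp)
  then show ?thesis
    using assms by (simp add: mellin_integrand_def zeta_kernel_def algebra_simps)
qed

lemma mellin_zeta_kernel_gt_1:
  assumes "Re s > 1"
  shows "mellin_integrand zeta_kernel s absolutely_integrable_on {0<..}"
    and "mellin zeta_kernel s = Gamma s * (\<Sum>n. 1 / of_nat (Suc n) powr s) - Gamma (s - 1) - Gamma s / 2"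
proof -
  let ?p = "mellin_integrand (\<lambda>x. of_real (1 / (exp x - 1))) s"
  let ?e = "mellin_integrand (\<lambda>x. of_real (exp (- 1 * x)))"
  have p: "?p absolutely_integrable_on {0<..}" using assms by (rule mellin_planck)
  have e: "?e s absolutely_integrable_on {0<..}" "?e (s - 1) absolutely_integrable_on {0<..}"
    using assms mellin_exp(1)[of s 1] mellin_exp(1)[of "s - 1" 1] by auto
  have "(\<lambda>x. ?p x - ?e (s - 1) x - ?e s x / 2) absolutely_integrable_on {0<..}"
    by (intro set_integral_diff set_integrable_divide p e)
  also have "?this \<longleftrightarrow> mellin_integrand zeta_kernel s absolutely_integrable_on {0<..}"
    by (intro set_integrable_cong) (auto simp: mellin_integrand_zeta_kernel)
  finally show "mellin_integrand zeta_kernel s absolutely_integrable_on {0<..}" .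
  have "mellin zeta_kernel s = integral {0<..} (\<lambda>x. ?p x - ?e (s - 1) x - ?e s x / 2)"
    unfolding mellin_def by (intro integral_cong) (auto simp: mellin_integrand_zeta_kernel)
  also have "\<dots> = mellin (\<lambda>x. of_real (1 / (exp x - 1))) s
      - mellin (\<lambda>x. of_real (exp (- 1 * x))) (s - 1) - mellin (\<lambda>x. of_real (exp (- 1 * x))) s / 2"
    using p e unfolding mellin_def
    by (subst integral_diff integral_divide; (intro integrable_diff integrable_on_divide)?;
        auto intro: set_lebesgue_integral_eq_integral(1))+
  also have "\<dots> = Gamma s * (\<Sum>n. 1 / of_nat (Suc n) powr s) - Gamma (s - 1) - Gamma s / 2"
    using assms mellin_planck(2)[OF assms] mellin_exp(2)[of s 1] mellin_exp(2)[of "s - 1" 1] by simp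
  finally show "mellin zeta_kernel s = Gamma s * (\<Sum>n. 1 / of_nat (Suc n) powr s) - Gamma (s - 1) - Gamma s / 2" .
qed

text \<open>Each partial fraction has the transform given by \<open>mellin_rational\<close>, a
  constant times (n + 1)^(s-1). The sum over n converges because s < 0, and it is the Dirichlet
  series of zeta at 1 - s.\<close>

lemma mellin_partial_fractions:
  assumes "-1 < s" "s < (0::real)"
  shows "mellin_integrand (\<lambda>x. of_real (1 / (exp x - 1) - 1 / x + 1 / 2)) (of_real s) absolutely_integrable_on {0<..}"
    and "mellin (\<lambda>x. of_real (1 / (exp x - 1) - 1 / x + 1 / 2)) (of_real s)
           = of_real (pi / cos (pi * s / 2) * (2 * pi) powr (s - 1) * (\<Sum>n. real (Suc n) powr (s - 1)))"
proof -
  define c where "c = (\<lambda>n. (2 * pi * real (Suc n)) powr (s - 1) * pi / cos (pi * s / 2))"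
  define G where "G = (\<lambda>n x. 2 * x / (x\<^sup>2 + (2 * pi * real (Suc n))\<^sup>2))"
  have c_eq: "c = (\<lambda>n. pi / cos (pi * s / 2) * (2 * pi) powr (s - 1) * real (Suc n) powr (s - 1))"
    by (auto simp: c_def powr_mult)
  have sm: "summable (\<lambda>n. real (Suc n) powr (s - 1))"
    using assms by (simp add: summable_real_powr_iff summable_Suc_iff[of "\<lambda>n. real n powr (s - 1)"] del: of_nat_Suc)
  have c: "summable c" unfolding c_eq by (intro summable_mult sm)
  have int: "mellin_integrand (\<lambda>x. of_real (G n x)) (of_real s) absolutely_integrable_on {0<..}" for n
    unfolding G_def by (rule mellin_rational) (use assms in auto)
  have mel: "mellin (\<lambda>x. of_real (G n x)) (of_real s) = of_real (c n)" for n
    unfolding G_def c_def by (rule mellin_rational) (use assms in auto)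
  have mel': "mellin (\<lambda>x. of_real (G n x)) (of_real (Re (of_real s))) = of_real (c n)" for n
    using mel by simp
  have sums: "(\<lambda>n. G n x) sums (1 / (exp x - 1) - 1 / x + 1 / 2)" if "x > 0" for x
    unfolding G_def by (rule planck_partial_fractions[OF that])
  have nonneg: "G n x \<ge> 0" if "x > 0" for n x
    using that by (auto simp: G_def)
  note S = mellin_sums[OF nonneg int mel' c sums]
  show "mellin_integrand (\<lambda>x. of_real (1 / (exp x - 1) - 1 / x + 1 / 2)) (of_real s) absolutely_integrable_on {0<..}"
    by (rule S(1))
  have "(\<lambda>n. complex_of_real (c n)) sums mellin (\<lambda>x. of_real (1 / (exp x - 1) - 1 / x + 1 / 2)) (of_real s)"
    unfolding mel[symmetric] by (rule S(2))
  moreover have "(\<lambda>n. complex_of_real (c n)) sums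
      of_real (pi / cos (pi * s / 2) * (2 * pi) powr (s - 1) * (\<Sum>n. real (Suc n) powr (s - 1)))"
    unfolding c_eq by (intro sums_of_real sums_mult summable_sums sm)
  ultimately show "mellin (\<lambda>x. of_real (1 / (exp x - 1) - 1 / x + 1 / 2)) (of_real s)
           = of_real (pi / cos (pi * s / 2) * (2 * pi) powr (s - 1) * (\<Sum>n. real (Suc n) powr (s - 1)))"
    by (rule sums_unique2)
qed

text \<open>The kernel equals the partial fraction sum minus (e^(-x) - 1 + x)/x plus (1 - e^(-x))/2.
  The regularized Gamma integrals therefore contribute the same terms - Gamma(s - 1) - Gamma(s)/2 as
  for Re s > 1.\<close>

lemma mellin_zeta_kernel_neg:
  assumes "-1 < s" "s < (0::real)"
  shows "mellin_integrand zeta_kernel (of_real s) absolutely_integrable_on {0<..}"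
    and "mellin zeta_kernel (of_real s)
           = of_real (pi / cos (pi * s / 2) * (2 * pi) powr (s - 1) * (\<Sum>n. real (Suc n) powr (s - 1)))
             - Gamma (of_real s - 1) - Gamma (of_real s) / 2"
proof -
  let ?h = "mellin_integrand (\<lambda>x. of_real (1 / (exp x - 1) - 1 / x + 1 / 2)) (of_real s)"
  let ?p1 = "\<lambda>x. x powr (s - 2) * (exp (- x) - 1 + x)"
  let ?p2 = "\<lambda>x. x powr (s - 1) * (1 - exp (- x))"
  have exp1: "exp (-x) \<ge> 1 - x" for x :: real using exp_ge_add_one_self[of "-x"] by simp
  have nonneg: "0 \<le> ?p1 x" for x using exp1[of x] by (intro mult_nonneg_nonneg) auto
  note p1 = has_integral_Gamma_regularized(2)[OF assms]
  note p2 = has_integral_Gamma_regularized(1)[OF assms]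
  have h: "?h absolutely_integrable_on {0<..}" by (rule mellin_partial_fractions[OF assms])
  have p_abs: "?p1 absolutely_integrable_on {0<..}" "?p2 absolutely_integrable_on {0<..}"
    using p1 p2 nonneg by (auto intro!: nonnegative_absolutely_integrable_1)
  have abs: "(\<lambda>x. complex_of_real (?p1 x)) absolutely_integrable_on {0<..}"
    "(\<lambda>x. complex_of_real (?p2 x)) absolutely_integrable_on {0<..}"
    by (intro absolutely_integrable_of_real p_abs)+
  have eq: "?h x - complex_of_real (?p1 x) + complex_of_real (?p2 x) / 2 = mellin_integrand zeta_kernel (of_real s) x"
    if "x \<in> {0<..}" for x
  proof -
    have p: "x powr (s - 2) = x powr (s - 1) / x"
      using that by (simp add: powr_diff powr_numeral power2_eq_square)
    have "complex_of_real x powr (of_real s - 1) = of_real (x powr (s - 1))"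
      using that powr_of_real[of x "s - 1"] by simp
    then have M: "mellin_integrand zeta_kernel (of_real s) x =
        of_real (x powr (s - 1) * (1 / (exp x - 1) - exp (- x) * (1 / x + 1 / 2)))"
      and H: "?h x = of_real (x powr (s - 1) * (1 / (exp x - 1) - 1 / x + 1 / 2))"
      unfolding mellin_integrand_def zeta_kernel_def by simp_all
    have "x powr (s - 1) * (1 / (exp x - 1) - 1 / x + 1 / 2) - ?p1 x + ?p2 x / 2
        = x powr (s - 1) * (1 / (exp x - 1) - exp (- x) * (1 / x + 1 / 2))"
      unfolding p using that by (simp add: algebra_simps add_divide_distrib diff_divide_distrib)
    from arg_cong[OF this, of complex_of_real] show ?thesis
      unfolding M H by (simp only: of_real_add of_real_diff of_real_divide of_real_numeral)
  qed
  have "(\<lambda>x. ?h x - complex_of_real (?p1 x) + complex_of_real (?p2 x) / 2) absolutely_integrable_on {0<..}"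
    by (intro set_integral_add set_integral_diff set_integrable_divide h abs)
  also have "?this \<longleftrightarrow> mellin_integrand zeta_kernel (of_real s) absolutely_integrable_on {0<..}"
    by (intro set_integrable_cong) (use eq in auto)
  finally show "mellin_integrand zeta_kernel (of_real s) absolutely_integrable_on {0<..}" .
  have hI: "(?h has_integral of_real (pi / cos (pi * s / 2) * (2 * pi) powr (s - 1) * (\<Sum>n. real (Suc n) powr (s - 1)))) {0<..}"
    using set_lebesgue_integral_eq_integral(1)[OF h] mellin_partial_fractions(2)[OF assms]
    unfolding mellin_def has_integral_iff by blast
  have "((\<lambda>x. ?h x - complex_of_real (?p1 x) + complex_of_real (?p2 x) / 2) has_integral
      of_real (pi / cos (pi * s / 2) * (2 * pi) powr (s - 1) * (\<Sum>n. real (Suc n) powr (s - 1)))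
      - of_real (Gamma (s - 1)) + of_real (- Gamma s) / 2) {0<..}"
    by (intro has_integral_add has_integral_diff has_integral_divide hI has_integral_of_real p1 p2)
  from has_integral_eq[OF eq this]
  show "mellin zeta_kernel (of_real s)
           = of_real (pi / cos (pi * s / 2) * (2 * pi) powr (s - 1) * (\<Sum>n. real (Suc n) powr (s - 1)))
             - Gamma (of_real s - 1) - Gamma (of_real s) / 2"
    unfolding mellin_def by (subst integral_unique) (simp_all flip: Gamma_complex_of_real)
qed

text \<open>
  No estimate of the kernel is needed: convergence for \<open>-1 < s < 0\<close> and for \<open>Re s > 1\<close> is known
  termwise, and the range in between follows by interpolation.
\<close>

lemma holomorphic_mellin_zeta_kernel: "mellin zeta_kernel holomorphic_on {s. Re s > -1}"
proof -
  have "mellin zeta_kernel field_differentiable at s" if "Re s > -1" for s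
  proof -
    \<comment> \<open>The midpoint of -1 and min(Re s, 0) lies in (-1, 0) and to the left of s;
      together with \<open>?b\<close> it bounds a strip around s at whose ends convergence is
      known.\<close>
    define a where "a = (min (Re s) 0 - 1) / 2"
    have a: "-1 < a" "a < 0" "a < Re s" using that by (auto simp: a_def min_def)
    let ?b = "of_real (max (Re s) 1 + 1) :: complex"
    have "mellin zeta_kernel holomorphic_on {z. Re (of_real a) < Re z \<and> Re z < Re ?b}"
      by (intro holomorphic_mellin continuous_on_zeta_kernel mellin_zeta_kernel_neg mellin_zeta_kernel_gt_1)
         (use a in auto)
    moreover have "open {z. Re (of_real a) < Re z \<and> Re z < Re ?b}"
      unfolding Collect_conj_eq by (intro open_Int open_halfspace_Re_gt open_halfspace_Re_lt)
    ultimately show ?thesis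
      by (rule holomorphic_on_imp_differentiable_at) (use a in auto)
  qed
  then show ?thesis by (auto simp: holomorphic_on_def field_differentiable_at_within)
qed

text \<open>The Mellin identity for Re s > 1, divided by Gamma(s) and solved for the Dirichlet
  series; Gamma(s - 1) / Gamma(s) gives the pole term 1/(s - 1). Using the entire function
  \<open>rGamma\<close> keeps the formula holomorphic at s = 0.\<close>

definition zeta_half :: "complex \<Rightarrow> complex" where
  "zeta_half s = rGamma s * mellin zeta_kernel s + 1 / (s - 1) + 1 / 2"

lemma holomorphic_zeta_half: "zeta_half holomorphic_on {s. Re s > -1} - {1}"
  unfolding zeta_half_def
  by (intro holomorphic_intros holomorphic_on_subset[OF holomorphic_mellin_zeta_kernel]) auto

lemma rGamma_mult_Gamma:
  fixes z :: complex
  assumes "z \<notin> \<int>\<^sub>\<le>\<^sub>0"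
  shows "rGamma z * Gamma z = 1"
  using assms by (simp add: Gamma_def rGamma_eq_zero_iff)

lemma rGamma_mult_Gamma_minus1:
  fixes z :: complex
  assumes "z \<notin> \<int>\<^sub>\<le>\<^sub>0"
  shows "rGamma z * Gamma (z - 1) = 1 / (z - 1)"
proof -
  have "rGamma (z - 1) = (z - 1) * rGamma z"
    using rGamma_plus1[of "z - 1"] by simp
  then show ?thesis
    using assms by (simp add: Gamma_def rGamma_eq_zero_iff divide_simps)
qed

lemma zeta_half_gt_1:
  assumes "Re s > 1"
  shows "zeta_half s = (\<Sum>n. 1 / of_nat (Suc n) powr s)"
proof -
  have "s \<notin> \<int>\<^sub>\<le>\<^sub>0"
    using assms by (auto elim!: nonpos_Ints_cases)
  then have "rGamma s * Gamma s = 1" "rGamma s * Gamma (s - 1) = 1 / (s - 1)"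
    by (rule rGamma_mult_Gamma, rule rGamma_mult_Gamma_minus1)
  then show ?thesis
    unfolding zeta_half_def mellin_zeta_kernel_gt_1(2)[OF assms]
    by (simp add: right_diff_distrib mult.assoc[symmetric] del: of_nat_Suc)
qed

section \<open>Functional equation and identification of zeta\<close>

definition zeta_factor :: "complex \<Rightarrow> complex" where
  "zeta_factor s = 2 * cos (of_real pi * s / 2) * Gamma s * of_real (2 * pi) powr (- s)"

text \<open>Both sides equal the series \<open>S\<close>. On the left, 1 - s > 1 lies in the range
  of the Dirichlet series; on the right, the two Gamma terms cancel 1/(s - 1) + 1/2, and the
  remaining cosine and powers of 2 pi cancel against \<open>zeta_factor\<close>.\<close>

lemma zeta_half_reflection_neg:
  assumes "-1 < s" "s < (0::real)"
  shows "zeta_half (1 - of_real s) = zeta_factor (of_real s) * zeta_half (of_real s)"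
proof -
  define S where "S = (\<Sum>n. real (Suc n) powr (s - 1))"
  have sm: "summable (\<lambda>n. real (Suc n) powr (s - 1))"
    using assms by (simp add: summable_real_powr_iff summable_Suc_iff[of "\<lambda>n. real n powr (s - 1)"] del: of_nat_Suc)
  have "s \<notin> \<int>"
  proof
    assume "s \<in> \<int>"
    then obtain n where "s = of_int n" by (auto elim: Ints_cases)
    then show False using assms by simp
  qed
  then have nz: "complex_of_real s \<notin> \<int>\<^sub>\<le>\<^sub>0"
    by (auto dest: nonpos_Ints_Int)
  note G = rGamma_mult_Gamma[OF nz] rGamma_mult_Gamma_minus1[OF nz]
  have zs: "zeta_half (of_real s) = rGamma (of_real s) * of_real (pi / cos (pi * s / 2) * (2 * pi) powr (s - 1) * S)"
    unfolding zeta_half_def mellin_zeta_kernel_neg(2)[OF assms] S_def[symmetric]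
    using G by (simp add: right_diff_distrib)
  have c: "cos (pi * s / 2) \<noteq> 0"
  proof -
    have "s < 1" using assms by simp
    then have "cos (pi * s / 2) > 0"
      using mult_strict_left_mono[OF assms(1) pi_gt_zero] mult_strict_left_mono[OF assms(2) pi_gt_zero]
      by (intro cos_gt_zero_pi) simp_all
    then show ?thesis by simp
  qed
  have "(\<lambda>n. 1 / of_nat (Suc n) powr (1 - complex_of_real s)) = (\<lambda>n. of_real (real (Suc n) powr (s - 1)))"
  proof
    fix n
    have "of_real (real (Suc n)) powr (1 - complex_of_real s) = of_real (real (Suc n) powr (1 - s))"
      using powr_of_real[of "real (Suc n)" "1 - s"] by simp
    moreover have "real (Suc n) powr (s - 1) = 1 / real (Suc n) powr (1 - s)"
      using powr_minus_divide[of "real (Suc n)" "1 - s"] by simp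
    ultimately show "1 / of_nat (Suc n) powr (1 - complex_of_real s) = of_real (real (Suc n) powr (s - 1))"
      by (simp only: of_real_divide of_real_1 of_real_of_nat_eq)
  qed
  then have "zeta_half (1 - of_real s) = of_real S"
    using zeta_half_gt_1[of "1 - of_real s"] assms
    by (simp add: S_def suminf_of_real[OF sm] del: of_nat_Suc)
  moreover have "zeta_factor (of_real s) * zeta_half (of_real s) = of_real S"
  proof -
    have "cos (complex_of_real pi * of_real s / 2) = of_real (cos (pi * s / 2))"
      by (simp flip: cos_of_real)
    moreover have "complex_of_real (2 * pi) powr (- of_real s) = of_real ((2 * pi) powr (- s))"
      using powr_of_real[of "2 * pi" "- s"] by simp
    ultimately have "zeta_factor (of_real s) * zeta_half (of_real s) =
        of_real (2 * cos (pi * s / 2) * (2 * pi) powr (- s) * (pi / cos (pi * s / 2) * (2 * pi) powr (s - 1) * S))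
        * (rGamma (of_real s) * Gamma (of_real s))"
      unfolding zeta_factor_def zs by simp
    also have "2 * cos (pi * s / 2) * (2 * pi) powr (- s) * (pi / cos (pi * s / 2) * (2 * pi) powr (s - 1) * S)
        = 2 * pi * ((2 * pi) powr (- s) * (2 * pi) powr (s - 1)) * S"
      using c by (simp add: field_simps)
    also have "(2 * pi) powr (- s) * (2 * pi) powr (s - 1) = 1 / (2 * pi)"
      unfolding powr_add[symmetric] by (simp add: powr_minus_divide)
    finally show ?thesis using G(1) by simp
  qed
  ultimately show ?thesis by simp
qed

lemma holomorphic_zeta_factor: "A \<inter> \<int>\<^sub>\<le>\<^sub>0 = {} \<Longrightarrow> zeta_factor holomorphic_on A"
  unfolding zeta_factor_def by (intro holomorphic_intros) auto

text \<open>Identity theorem: the equation holds on the real segment (-1, 0), which accumulates at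
  -1/2. The strip -1 < Re s < 2 is invariant under s -> 1 - s; the points 0 and 1, where one of the
  functions involved may be singular, are removed without disconnecting it.\<close>

lemma zeta_half_reflection:
  assumes "-1 < Re s" "Re s < 2" "s \<noteq> 0" "s \<noteq> 1"
  shows "zeta_half (1 - s) = zeta_factor s * zeta_half s"
proof -
  define T where "T = {s. -1 < Re s \<and> Re s < 2}"
  have T: "open T" "convex T"
    unfolding T_def Collect_conj_eq
    by (auto intro!: open_Int open_halfspace_Re_gt open_halfspace_Re_lt convex_Int
          convex_halfspace_Re_gt convex_halfspace_Re_lt)
  have "connected (T - {0} - {1})"
    using T by (intro connected_open_delete open_delete convex_connected) auto
  also have "T - {0} - {1} = T - {0, 1}" by blast
  finally have conn: "connected (T - {0, 1})" .
  have nonpos: "(T - {0, 1}) \<inter> \<int>\<^sub>\<le>\<^sub>0 = {}"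
    by (auto simp: T_def elim!: nonpos_Ints_cases)
  have "zeta_half (1 - s) - zeta_factor s * zeta_half s = 0"
  proof (rule analytic_continuation[of "\<lambda>s. zeta_half (1 - s) - zeta_factor s * zeta_half s" "T - {0, 1}" "of_real ` {-1<..<0}" "- 1 / 2"])
    have "zeta_half \<circ> (\<lambda>s. 1 - s) holomorphic_on (T - {0, 1})"
      by (rule holomorphic_on_compose_gen[OF _ holomorphic_zeta_half]) (auto simp: T_def intro!: holomorphic_intros)
    then have "(\<lambda>s. zeta_half (1 - s)) holomorphic_on (T - {0, 1})"
      by (simp add: o_def)
    then show "(\<lambda>s. zeta_half (1 - s) - zeta_factor s * zeta_half s) holomorphic_on (T - {0, 1})"
      by (intro holomorphic_intros holomorphic_zeta_factor nonpos holomorphic_on_subset[OF holomorphic_zeta_half])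
         (auto simp: T_def)
    show "open (T - {0, 1})" using T by (intro open_Diff) auto
    show "of_real ` {-1<..<0} \<subseteq> T - {0, 1}" by (auto simp: T_def)
    show "- 1 / 2 \<in> T - {0, 1}" by (simp add: T_def complex_eq_iff)
    show "(- 1 / 2 :: complex) islimpt of_real ` {-1<..<0}"
    proof -
      have "(- 1 / 2 :: real) islimpt {-1<..<0}" by (rule interior_limit_point) auto
      moreover have "eventually (\<lambda>y. complex_of_real y \<noteq> of_real (- 1 / 2)) (at (- 1 / 2))"
        unfolding of_real_eq_iff by (rule eventually_neq_at_within)
      ultimately have "complex_of_real (- 1 / 2) islimpt of_real ` {-1<..<0}"
        by (intro islimpt_isCont_image) auto
      then show ?thesis by simp
    qed
  qed (use conn zeta_half_reflection_neg assms in \<open>auto simp: T_def\<close>)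
  then show ?thesis by simp
qed

text \<open>The definite description is justified by an explicit witness \<open>Z\<close>:
  \<open>zeta_half\<close> to the right of Re s = -1, continued to the left by the functional
  equation, which also makes the two formulas agree on the overlap -1 < Re s < 0. Uniqueness is
  analytic continuation on the connected punctured plane, with the value at 1 prescribed
  separately.\<close>

lemma
  shows holomorphic_zeta: "zeta holomorphic_on - {1}"
    and zeta_eq_zeta_half: "Re s > -1 \<Longrightarrow> s \<noteq> 1 \<Longrightarrow> zeta s = zeta_half s"
proof -
  define P where "P = (\<lambda>f. f holomorphic_on (- {1}) \<and>
      (\<forall>s. Re s > 1 \<longrightarrow> f s = (\<Sum>n. 1 / of_nat (Suc n) powr s)) \<and> f 1 = (0::complex))"
  define Z where "Z = (\<lambda>s. if s = 1 then 0 else if Re s > -1 then zeta_half s else zeta_factor (1 - s) * zeta_half (1 - s))"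
  have "Z holomorphic_on ({s. Re s > -1} - {1}) \<union> {s. Re s < 0}"
  proof (rule holomorphic_on_Un)
    show "Z holomorphic_on {s. Re s > -1} - {1}"
      by (rule holomorphic_transform[OF holomorphic_zeta_half]) (auto simp: Z_def)
    have "zeta_factor \<circ> (\<lambda>s. 1 - s) holomorphic_on {s. Re s < 0}"
      by (rule holomorphic_on_compose_gen[OF _ holomorphic_zeta_factor[of "{s. Re s > 1}"]])
         (auto intro!: holomorphic_intros elim!: nonpos_Ints_cases)
    moreover have "zeta_half \<circ> (\<lambda>s. 1 - s) holomorphic_on {s. Re s < 0}"
      by (rule holomorphic_on_compose_gen[OF _ holomorphic_zeta_half]) (auto intro!: holomorphic_intros)
    ultimately have "(\<lambda>s. zeta_factor (1 - s) * zeta_half (1 - s)) holomorphic_on {s. Re s < 0}"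
      unfolding o_def by (rule holomorphic_on_mult)
    then show "Z holomorphic_on {s. Re s < 0}"
    proof (rule holomorphic_transform)
      fix s assume "s \<in> {s. Re s < 0}"
      then show "zeta_factor (1 - s) * zeta_half (1 - s) = Z s"
        using zeta_half_reflection[of "1 - s"] by (cases "s = 0") (auto simp: Z_def)
    qed
  qed (auto intro!: open_Diff open_halfspace_Re_gt open_halfspace_Re_lt)
  moreover have "({s. Re s > -1} - {1}) \<union> {s. Re s < 0} = - {1}" by auto
  ultimately have "P Z" by (auto simp: P_def Z_def zeta_half_gt_1)
  moreover have "f = Z" if "P f" for f
  proof
    fix s
    show "f s = Z s"
    proof (cases "s = 1")
      case True
      then show ?thesis using \<open>P f\<close> by (simp add: P_def Z_def)
    next
      case False
      show ?thesis
      proof (rule analytic_continuation_open[of "{s. Re s > 1}" "- {1}" f Z])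
        show "{s. Re s > 1} \<noteq> {}" by (auto intro!: exI[of _ 2])
        show "connected (- {1 :: complex})" by (rule connected_punctured_universe) auto
      qed (use \<open>P f\<close> \<open>P Z\<close> False in \<open>auto simp: P_def open_halfspace_Re_gt\<close>)
    qed
  qed
  ultimately have "zeta = Z"
    unfolding zeta_def P_def[symmetric] by (rule the_equality)
  with \<open>P Z\<close> show "zeta holomorphic_on - {1}" by (simp add: P_def)
  show "zeta s = zeta_half s" if "Re s > -1" "s \<noteq> 1"
    unfolding \<open>zeta = Z\<close> using that by (simp add: Z_def)
qed

lemma zeta_reflection:
  assumes "0 < Re s" "Re s < 1"
  shows "zeta (1 - s) = zeta_factor s * zeta s"
  using zeta_half_reflection[of s] assms zeta_eq_zeta_half[of s] zeta_eq_zeta_half[of "1 - s"]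
  by (auto simp: complex_eq_iff)

section \<open>Zeros of the logarithmic derivative of the factor\<close>

lemma sums_strict_mono:
  fixes f g :: "nat \<Rightarrow> real"
  assumes "f sums a" "g sums b" "\<And>n. f n < g n"
  shows "a < b"
proof -
  have d: "(\<lambda>n. g n - f n) sums (b - a)" by (intro sums_diff assms)
  have "0 < (\<Sum>n. g n - f n)"
    using assms(3) by (intro suminf_pos sums_summable[OF d]) auto
  then show ?thesis using sums_unique[OF d] by simp
qed

text \<open>Real and imaginary parts of psi(s) + gamma = sum over k of 1/(k + 1) - 1/(s + k). In
  this form monotonicity in Re s or Im s can be checked term by term.\<close>

lemma Digamma_sums:
  fixes s :: complex
  assumes "s \<noteq> 0"
  shows Im_Digamma_sums: "(\<lambda>k. Im s / ((Re s + real k)\<^sup>2 + (Im s)\<^sup>2)) sums Im (Digamma s)"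
    and Re_Digamma_sums: "(\<lambda>k. inverse (real (Suc k)) - (Re s + real k) / ((Re s + real k)\<^sup>2 + (Im s)\<^sup>2))
                            sums (Re (Digamma s) + euler_mascheroni)"
proof -
  have S: "(\<lambda>k. inverse (of_nat (Suc k)) - inverse (s + of_nat k)) sums (Digamma s + euler_mascheroni)"
    using summable_sums[OF summable_Digamma[OF assms]] by (simp add: Digamma_def)
  have e: "euler_mascheroni = complex_of_real euler_mascheroni" by simp
  have i: "inverse (complex_of_nat (Suc k)) = of_real (inverse (real (Suc k)))" for k by simp
  from sums_Im[OF S] show "(\<lambda>k. Im s / ((Re s + real k)\<^sup>2 + (Im s)\<^sup>2)) sums Im (Digamma s)"
    unfolding e i by (simp del: of_nat_Suc of_real_inverse of_real_euler_mascheroni)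
  from sums_Re[OF S] show "(\<lambda>k. inverse (real (Suc k)) - (Re s + real k) / ((Re s + real k)\<^sup>2 + (Im s)\<^sup>2))
       sums (Re (Digamma s) + euler_mascheroni)"
    unfolding e i by (simp del: of_nat_Suc of_real_inverse of_real_euler_mascheroni)
qed

lemma Im_Digamma_less:
  assumes "0 < a" "a < b" "t > 0"
  shows "Im (Digamma (Complex b t)) < Im (Digamma (Complex a t))"
proof (rule sums_strict_mono)
  show "(\<lambda>k. t / ((b + real k)\<^sup>2 + t\<^sup>2)) sums Im (Digamma (Complex b t))"
    "(\<lambda>k. t / ((a + real k)\<^sup>2 + t\<^sup>2)) sums Im (Digamma (Complex a t))"
    using Im_Digamma_sums[of "Complex b t"] Im_Digamma_sums[of "Complex a t"] assms by (auto simp: complex_eq_iff)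
  fix k
  have "(a + real k)\<^sup>2 < (b + real k)\<^sup>2" using assms by (intro power_strict_mono) auto
  then show "t / ((b + real k)\<^sup>2 + t\<^sup>2) < t / ((a + real k)\<^sup>2 + t\<^sup>2)"
    using assms by (intro divide_strict_left_mono mult_pos_pos add_pos_pos) auto
qed

lemma Re_Digamma_less:
  assumes "0 < a" "0 \<le> t" "t < u"
  shows "Re (Digamma (Complex a t)) < Re (Digamma (Complex a u))"
proof -
  have "Re (Digamma (Complex a t)) + euler_mascheroni < Re (Digamma (Complex a u)) + euler_mascheroni"
  proof (rule sums_strict_mono)
    show "(\<lambda>k. inverse (real (Suc k)) - (a + real k) / ((a + real k)\<^sup>2 + t\<^sup>2)) sums
        (Re (Digamma (Complex a t)) + euler_mascheroni)"
      "(\<lambda>k. inverse (real (Suc k)) - (a + real k) / ((a + real k)\<^sup>2 + u\<^sup>2)) sums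
        (Re (Digamma (Complex a u)) + euler_mascheroni)"
      using Re_Digamma_sums[of "Complex a t"] Re_Digamma_sums[of "Complex a u"] assms
      by (auto simp: complex_eq_iff)
    fix k
    have "t\<^sup>2 < u\<^sup>2" using assms by (intro power_strict_mono) auto
    then have "(a + real k) / ((a + real k)\<^sup>2 + u\<^sup>2) < (a + real k) / ((a + real k)\<^sup>2 + t\<^sup>2)"
      using assms by (intro divide_strict_left_mono mult_pos_pos add_pos_nonneg) auto
    then show "inverse (real (Suc k)) - (a + real k) / ((a + real k)\<^sup>2 + t\<^sup>2)
        < inverse (real (Suc k)) - (a + real k) / ((a + real k)\<^sup>2 + u\<^sup>2)" by simp
  qed
  then show ?thesis by simp
qed

lemma Im_Digamma_half: "Im (Digamma (Complex (1/2) t)) = pi / 2 * (sinh (pi * t) / cosh (pi * t))"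
proof -
  let ?z = "Complex (1/2) t"
  have z: "?z \<notin> \<int>" 
  proof
    assume "?z \<in> \<int>"
    then obtain n where "?z = of_int n" by (auto elim: Ints_cases)
    then have "of_int (2 * n) = (of_int 1 :: real)" by (simp add: complex_eq_iff)
    then have "2 * n = 1" by (simp only: of_int_eq_iff)
    then show False by presburger
  qed
  have "Im (Digamma (1 - ?z)) = - Im (Digamma ?z)"
  proof -
    have "(\<lambda>k. - (t / ((1/2 + real k)\<^sup>2 + t\<^sup>2))) sums Im (Digamma (1 - ?z))"
      using Im_Digamma_sums[of "1 - ?z"] by (simp add: complex_eq_iff)
    moreover have "(\<lambda>k. - (t / ((1/2 + real k)\<^sup>2 + t\<^sup>2))) sums (- Im (Digamma ?z))"
      using Im_Digamma_sums[of ?z] by (intro sums_minus) (simp add: complex_eq_iff)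
    ultimately show ?thesis by (rule sums_unique2)
  qed
  moreover have "Im (Digamma (1 - ?z) - Digamma ?z) = - pi * (sinh (pi * t) / cosh (pi * t))"
  proof -
    have w: "of_real pi * ?z = of_real pi / 2 + \<i> * of_real (pi * t)"
      by (simp add: complex_eq_iff)
    have "\<i> * (\<i> * complex_of_real (pi * t)) = - of_real (pi * t)" by simp
    then have "cot (of_real pi * ?z) = - \<i> * of_real (sinh (pi * t) / cosh (pi * t))"
      unfolding cot_def w cos_add sin_add sin_conv_sinh[of "\<i> * of_real (pi * t)"] cos_conv_cosh[of "\<i> * of_real (pi * t)"]
      by (simp add: cosh_of_real sinh_of_real del: of_real_mult)
    then show ?thesis unfolding Digamma_reflection[OF z] by simp
  qed
  ultimately show ?thesis by simp
qed

text \<open>Multiply sin z / cos z by the conjugate of cos z; the denominator is |cos z|^2 =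
  (cos(2x) + cosh(2y)) / 2. At zeros of the cosine both sides are 0 by the convention for division
  by zero.\<close>

lemma
  shows Re_tan: "Re (tan z) = sin (2 * Re z) / (cos (2 * Re z) + cosh (2 * Im z))"
    and Im_tan: "Im (tan z) = sinh (2 * Im z) / (cos (2 * Re z) + cosh (2 * Im z))"
proof -
  define x y where "x = Re z" and "y = Im z"
  have *: "Re (sin z) = sin x * cosh y" "Im (sin z) = cos x * sinh y"
    "Re (cos z) = cos x * cosh y" "Im (cos z) = - (sin x * sinh y)"
    by (simp_all add: Re_sin Im_sin Re_cos Im_cos x_def y_def cosh_field_def sinh_field_def field_simps)
  have sc: "(sin x)\<^sup>2 = 1 - (cos x)\<^sup>2" and ch: "(cosh y)\<^sup>2 = 1 + (sinh y)\<^sup>2"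
    using sin_cos_squared_add[of x] by (simp_all add: cosh_square_eq algebra_simps)
  have "cos (2 * x) + cosh (2 * y) = 2 * ((cos x * cosh y)\<^sup>2 + (sin x * sinh y)\<^sup>2)"
    unfolding power_mult_distrib sc ch cos_double_cos cosh_double by (simp add: algebra_simps)
  moreover have "sin (2 * x) = 2 * (sin x * cosh y * (cos x * cosh y) - cos x * sinh y * (sin x * sinh y))"
  proof -
    have "sin x * cosh y * (cos x * cosh y) - cos x * sinh y * (sin x * sinh y) = sin x * cos x * ((cosh y)\<^sup>2 - (sinh y)\<^sup>2)"
      by (simp add: power2_eq_square algebra_simps)
    then show ?thesis unfolding ch by (simp add: sin_double)
  qed
  moreover have "sinh (2 * y) = 2 * (cos x * sinh y * (cos x * cosh y) + sin x * cosh y * (sin x * sinh y))"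
  proof -
    have "cos x * sinh y * (cos x * cosh y) + sin x * cosh y * (sin x * sinh y) = sinh y * cosh y * ((cos x)\<^sup>2 + (sin x)\<^sup>2)"
      by (simp add: power2_eq_square algebra_simps del: sin_cos_squared_add sin_cos_squared_add2 sin_cos_squared_add3)
    then show ?thesis by (simp add: sinh_double)
  qed
  ultimately show "Re (tan z) = sin (2 * Re z) / (cos (2 * Re z) + cosh (2 * Im z))"
    "Im (tan z) = sinh (2 * Im z) / (cos (2 * Re z) + cosh (2 * Im z))"
    unfolding tan_def Re_divide Im_divide * x_def[symmetric] y_def[symmetric]
    by (simp_all only: mult_divide_mult_cancel_left_if power2_minus) simp_all
qed

section \<open>The logarithmic derivative on the left half of the critical strip\<close>

definition zeta_factor_logderiv :: "complex \<Rightarrow> complex" where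
  "zeta_factor_logderiv s = Digamma s - of_real (ln (2 * pi)) - of_real (pi / 2) * tan (of_real pi * s / 2)"

lemma cos_half_nonzero:
  assumes "0 < Re s" "Re s < 1"
  shows "cos (of_real pi * s / 2) \<noteq> 0"
proof
  assume "cos (of_real pi * s / 2) = 0"
  then obtain n :: int where "of_real pi * s / 2 = of_int n * of_real pi + of_real pi / 2"
    by (auto simp: cos_eq_0)
  then have "of_real pi * s = of_real pi * of_int (2 * n + 1)" by (simp add: field_simps)
  then have "s = of_int (2 * n + 1)" by (subst (asm) mult_cancel_left) simp
  then have "Re s = of_int (2 * n + 1)" by simp
  with assms have "0 < real_of_int (2 * n + 1)" "real_of_int (2 * n + 1) < 1" by simp_all
  then show False unfolding of_int_0_less_iff of_int_less_1_iff by presburger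
qed

lemma has_field_derivative_zeta_factor:
  assumes "0 < Re s" "Re s < 1"
  shows "(zeta_factor has_field_derivative zeta_factor s * zeta_factor_logderiv s) (at s)"
proof -
  have "s \<notin> \<int>\<^sub>\<le>\<^sub>0" using assms by (auto elim!: nonpos_Ints_cases)
  moreover have "Ln (complex_of_real (2 * pi)) = of_real (ln (2 * pi))" by (intro Ln_of_real) auto
  ultimately show ?thesis
    using cos_half_nonzero[OF assms] unfolding zeta_factor_def
    by (auto intro!: derivative_eq_intros simp: zeta_factor_logderiv_def tan_def powr_def field_simps simp del: of_real_mult)
qed

text \<open>On the critical line Im psi and the tangent term cancel exactly, by
  \<open>Im_Digamma_half\<close>. To its left Im psi is larger, while cos(pi a) > 0 enlarges the
  denominator in \<open>Im_tan\<close> and makes the subtracted term smaller.\<close>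

lemma Im_zeta_factor_logderiv_pos:
  assumes "0 < a" "a < 1 / 2" "t > 0"
  shows "Im (zeta_factor_logderiv (Complex a t)) > 0"
proof -
  have "pi * a < pi / 2" using mult_strict_left_mono[OF assms(2) pi_gt_zero] by simp
  then have "cos (pi * a) > 0" using assms by (intro cos_gt_zero_pi) (auto intro: less_trans[of _ 0])
  then have "sinh (pi * t) / (cos (pi * a) + cosh (pi * t)) < sinh (pi * t) / cosh (pi * t)"
    using assms by (intro divide_strict_left_mono mult_pos_pos add_pos_pos) auto
  then have "pi / 2 * (sinh (pi * t) / (cos (pi * a) + cosh (pi * t))) < Im (Digamma (Complex (1/2) t))"
    unfolding Im_Digamma_half by (intro mult_strict_left_mono) auto
  also have "\<dots> < Im (Digamma (Complex a t))" using assms by (rule Im_Digamma_less)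
  finally show ?thesis by (simp add: zeta_factor_logderiv_def Im_tan algebra_simps)
qed

text \<open>Monotonicity on the positive axis gives psi(a) <= psi(1/2) = - gamma - 2 ln 2 < 0. The
  subtracted terms ln(2 pi) and (pi/2) tan(pi a / 2) are nonnegative.\<close>

lemma Re_zeta_factor_logderiv_real_neg:
  assumes "0 < a" "a \<le> 1 / 2"
  shows "Re (zeta_factor_logderiv (of_real a)) < 0"
proof -
  have "0 < euler_mascheroni + 2 * ln (2::real)"
    using euler_mascheroni_pos by (intro add_pos_pos) auto
  then have half: "Digamma (1/2 :: real) < 0" by (simp add: Digamma_one_half)
  have "Digamma a \<le> Digamma (1/2)" using assms by (intro Digamma_real_mono) auto
  also have "\<dots> < 0" by (rule half)
  finally have "Re (Digamma (complex_of_real a)) < 0" using assms by (simp add: Polygamma_of_real)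
  moreover have "ln (2 * pi) > 0" using pi_gt3 by (intro ln_gt_zero) auto
  moreover have "pi / 2 * Re (tan (of_real pi * of_real a / 2)) \<ge> 0"
  proof -
    have "pi * a \<le> pi / 2" using assms by simp
    then have "sin (pi * a) \<ge> 0" "cos (pi * a) \<ge> 0" 
      using assms by (auto intro!: sin_ge_zero cos_ge_zero intro: order_trans[of _ 0])
    then show ?thesis by (simp add: Re_tan)
  qed
  moreover have "Re (zeta_factor_logderiv (of_real a)) =
      Re (Digamma (of_real a)) - ln (2 * pi) - pi / 2 * Re (tan (of_real pi * of_real a / 2))"
    by (simp add: zeta_factor_logderiv_def)
  ultimately show ?thesis by linarith
qed

text \<open>On the critical line Re tan(pi s / 2) = 1 / cosh(pi t), so the real part of the equation
  is the one defining \<open>rho_s\<close>. The given zero t supplies existence for the definite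
  description; uniqueness holds because \<open>Q\<close> increases while \<open>R\<close>
  decreases.\<close>

lemma zeta_factor_logderiv_half_eq_0:
  assumes "t > 0" "zeta_factor_logderiv (Complex (1/2) t) = 0"
  shows "rho_s = t"
proof -
  define R where "R = (\<lambda>t. (ln (2 * pi) * cosh (pi * t) + pi / 2) / cosh (pi * t))"
  define Q where "Q = (\<lambda>t. Re (Digamma (1 / 2 + \<i> * of_real t)))"
  have C: "1 / 2 + \<i> * of_real t = Complex (1/2) t" for t by (simp add: complex_eq_iff)
  have R: "R t = ln (2 * pi) + pi / 2 / cosh (pi * t)" for t
    by (simp add: R_def add_divide_distrib)
  have less: "Q u < Q v \<and> R v < R u" if "0 < u" "u < v" for u v
  proof
    show "Q u < Q v" unfolding Q_def C using that by (intro Re_Digamma_less) auto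
    have "cosh (pi * u) < cosh (pi * v)" using that by (simp add: cosh_real_nonneg_less_iff)
    then show "R v < R u" unfolding R by (intro add_strict_left_mono divide_strict_left_mono) auto
  qed
  have "Re (zeta_factor_logderiv (Complex (1/2) t)) = 0" using assms by simp
  then have "Q t = R t" unfolding Q_def R C
    by (simp add: zeta_factor_logderiv_def Re_tan)
  have uniq: "u = t" if u: "u > 0" "Q u = R u" for u
  proof (rule ccontr)
    assume "u \<noteq> t"
    then consider "u < t" | "t < u" by linarith
    then show False
      by cases (use less[OF u(1), of t] less[OF assms(1), of u] u(2) \<open>Q t = R t\<close> in linarith)+
  qed
  have "rho_s = (THE t. t > 0 \<and> Q t = R t)"
    by (simp only: rho_s_def Q_def R_def)
  also have "\<dots> = t"
    by (rule the_equality) (use assms(1) \<open>Q t = R t\<close> uniq in blast)+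
  finally show ?thesis .
qed

lemma zeta_factor_logderiv_nonzero:
  assumes "0 < a" "a \<le> 1 / 2" "t \<ge> 0" "Complex a t \<noteq> 1 / 2 + \<i> * of_real rho_s"
  shows "zeta_factor_logderiv (Complex a t) \<noteq> 0"
proof
  assume 0: "zeta_factor_logderiv (Complex a t) = 0"
  show False
  proof (cases "t = 0")
    case True
    then show False using Re_zeta_factor_logderiv_real_neg[OF assms(1,2)] 0 by (simp add: complex_of_real_def)
  next
    case False
    then have "t > 0" using assms by simp
    with Im_zeta_factor_logderiv_pos[OF assms(1) _ this] 0 assms have "a = 1 / 2" by force
    with zeta_factor_logderiv_half_eq_0[OF \<open>t > 0\<close>] 0 have "rho_s = t" by simp
    with assms \<open>a = 1 / 2\<close> show False by (simp add: complex_eq_iff)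
  qed
qed

section \<open>Differentiated functional equation and the equivalence\<close>

lemma frakL_eq:
  assumes "0 < Re s" "Re s < 1" "deriv zeta s \<noteq> 0"
  shows "frakL s = - (zeta_factor s * zeta_factor_logderiv s * zeta s / deriv zeta s)"
proof -
  define S where "S = {z. 0 < Re z \<and> Re z < 1}"
  have S: "open S" "s \<in> S"
    using assms unfolding S_def Collect_conj_eq
    by (auto intro!: open_Int open_halfspace_Re_gt open_halfspace_Re_lt)
  have zeta': "(zeta has_field_derivative deriv zeta z) (at z)" if "z \<noteq> 1" for z
    by (rule holomorphic_derivI[OF holomorphic_zeta]) (use that in auto)
  have ne: "s \<noteq> 1" "1 - s \<noteq> 1" using assms by auto
  \<comment> \<open>The derivative of zeta(1 - z) at s is computed twice: by the chain rule, and by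
    the product rule after the functional equation, which holds on the open strip around s.\<close>
  have "((\<lambda>z. zeta (1 - z)) has_field_derivative deriv zeta (1 - s) * (0 - 1)) (at s)"
    by (rule DERIV_chain2[where g = "\<lambda>z. 1 - z", OF zeta'[OF ne(2)]]) (intro derivative_intros)
  moreover have "((\<lambda>z. zeta_factor z * zeta z) has_field_derivative
      zeta_factor s * zeta_factor_logderiv s * zeta s + deriv zeta s * zeta_factor s) (at s)"
    by (rule DERIV_mult[OF has_field_derivative_zeta_factor[OF assms(1,2)] zeta'[OF ne(1)]])
  then have "((\<lambda>z. zeta (1 - z)) has_field_derivative
      zeta_factor s * zeta_factor_logderiv s * zeta s + deriv zeta s * zeta_factor s) (at s)"
    by (rule has_field_derivative_transform_within_open[OF _ S]) (auto simp: S_def zeta_reflection)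
  ultimately have "deriv zeta (1 - s) * (0 - 1) =
      zeta_factor s * zeta_factor_logderiv s * zeta s + deriv zeta s * zeta_factor s"
    by (rule DERIV_unique)
  from arg_cong[OF this, of uminus] have "deriv zeta (1 - s) =
      - (zeta_factor s * zeta_factor_logderiv s * zeta s) - deriv zeta s * zeta_factor s"
    by simp
  \<comment> \<open>After division by zeta'(s) the last summand becomes -
    \<open>zeta_factor s\<close>, which cancels the second summand of \<open>frakL\<close>.\<close>
  then show ?thesis
    using assms(3) unfolding frakL_def zeta_factor_def[symmetric] by (simp add: field_simps)
qed

theorem mainTheorem2:
  fixes \<sigma> \<rho> :: real and s\<^sub>0 :: complex
  assumes "s\<^sub>0 = of_real \<sigma> + \<i> * of_real \<rho>"
    and "0 < \<sigma>" and "\<sigma> \<le> 1 / 2" and "\<rho> \<ge> 0"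
    and "deriv zeta s\<^sub>0 \<noteq> 0"
    and "s\<^sub>0 \<noteq> 1 / 2 + \<i> * of_real rho_s"
  shows "(zeta s\<^sub>0 = 0 \<longleftrightarrow> frakL s\<^sub>0 = 0) \<and>
         (zeta s\<^sub>0 = 0 \<longleftrightarrow>
            deriv zeta (1 - s\<^sub>0) / deriv zeta s\<^sub>0
              = - 2 * cos (of_real pi * s\<^sub>0 / 2) * Gamma s\<^sub>0 * of_real (2 * pi) powr (- s\<^sub>0))"
proof -
  have s: "s\<^sub>0 = Complex \<sigma> \<rho>" using assms(1) by (simp add: complex_eq_iff)
  have strip: "0 < Re s\<^sub>0" "Re s\<^sub>0 < 1" using assms(2,3) by (simp_all add: s)
  have "zeta_factor_logderiv s\<^sub>0 \<noteq> 0"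
    using zeta_factor_logderiv_nonzero[OF assms(2-4)] assms(6) by (simp add: s)
  moreover have "zeta_factor s\<^sub>0 \<noteq> 0"
  proof -
    have "Gamma s\<^sub>0 \<noteq> 0" using strip by (auto simp: Gamma_eq_zero_iff elim!: nonpos_Ints_cases)
    then show ?thesis using cos_half_nonzero[OF strip] by (simp add: zeta_factor_def)
  qed
  \<comment> \<open>In the product formula for \<open>frakL\<close> every factor other than zeta
    itself is now known to be nonzero.\<close>
  ultimately have 1: "zeta s\<^sub>0 = 0 \<longleftrightarrow> frakL s\<^sub>0 = 0"
    using assms(5) by (simp add: frakL_eq[OF strip assms(5)])
  have "frakL s\<^sub>0 = 0 \<longleftrightarrow> deriv zeta (1 - s\<^sub>0) / deriv zeta s\<^sub>0
      = - 2 * cos (of_real pi * s\<^sub>0 / 2) * Gamma s\<^sub>0 * of_real (2 * pi) powr (- s\<^sub>0)"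
    by (simp only: frakL_def add_eq_0_iff2 mult_minus_left)
  with 1 show ?thesis by simp
qed

end
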